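(* Fix $M>0$ and a level $\alpha\in(0,1)$. Consider testing $H_0:P=P_0$ against $H_1: P\in\mathcal P(\Delta_n,0,M)$ by the test $T_{\mathrm{MMD}}$, based on $X_1,\dots,X_n$ i.i.d. from $P$. (i) If $\sqrt{n}\,\Delta_n\to\infty$, then $\beta(T_{\mathrm{MMD}};\Delta_n,0,M)\to 0$ as $n\to\infty$. (ii) Conversely, there exists a constant $c_0>0$ such that $\liminf_{n\to\infty}\beta(T_{\mathrm{MMD}};c_0 n^{-1/2},0,M)>0$.
   Context: Standing setup. $(\mathcal X,\mathcal B)$ is a measurable space and $P_0$ a known probability measure on it. $K:\mathcal X\times\mathcal X\to\mathbb R$ is a symmetric, positive semidefinite, square-integrable (w.r.t. $P_0\otimes P_0$) kernel which is degenerate under $P_0$, i.e. $\mathbb E_{P_0}K(X,\cdot)=0$. It has the Mercer decomposition $K(x,x')=\sum_{k\ge1}\lambda_k\varphi_k(x)\varphi_k(x')$ with infinitely many eigenvalues $\lambda_1>\lambda_2>\cdots>0$, where $\{\varphi_k\}_{k\ge1}$ is an orthonormal basis of the space of $P_0$-mean-zero functions in $L_2(P_0)$ (so $\mathbb E_{P_0}\varphi_k(X)=0$). Assume $0<\liminf_{k\to\infty}k^{2s}\lambda_k\le\limsup_{k\to\infty}k^{2s}\lambda_k<\infty$ for some $s>1/2$, and $\sup_{k\ge1}\|\varphi_k\|_\infty<\infty$. $\mathcal H(K)$ is the RKHS of $K$, with $\|f\|_K^2=\sum_k\lambda_k^{-1}\langle f,\varphi_k\rangle_{L_2(P_0)}^2$.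 For $\theta>0$, $M>0$, $\mathcal F(\theta;M)$ is the set of $f\in L_2(P_0)$ such that for every $R>0$ there is $f_R\in\mathcal H(K)$ with $\|f_R\|_K\le R$ and $\|f-f_R\|_{L_2(P_0)}\le MR^{-1/\theta}$; and $\mathcal F(0;M)=\{f\in\mathcal H(K):\|f\|_K\le M\}$. For $\Delta>0$, $\theta\ge0$, $\mathcal P(\Delta,\theta,M)$ is the set of probability measures $P\ll P_0$ on $(\mathcal X,\mathcal B)$ with $u:=dP/dP_0-1\in\mathcal F(\theta;M)$ and $\chi^2(P,P_0):=\|u\|_{L_2(P_0)}^2\ge\Delta$. For a test $T:\mathcal X^n\to[0,1]$, its type II error is $\beta(T;\Delta,\theta,M)=\sup_{P\in\mathcal P(\Delta,\theta,M)}\mathbb E_P[1-T(X_1,\dots,X_n)]$, with $X_1,\dots,X_n$ i.i.d. $P$. MMD test: $\gamma^2(\widehat P_n,P_0)=\sum_{k\ge1}\lambda_k\big[\frac1n\sum_{i=1}^n\varphi_k(X_i)\big]^2$; $W=\sum_{k\ge1}\lambda_kZ_k^2$ with $Z_k$ i.i.d. $N(0,1)$, and $q_{w,1-\alpha}$ is the upper $\alpha$ quantile of $W$; $T_{\mathrm{MMD}}=\mathbf 1\{n\gamma^2(\widehat P_n,P_0)>q_{w,1-\alpha}\}$. *)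

theory Defs
  imports "HOL-Probability.Probability"
begin

(* Indexing convention: the paper's eigenpairs (lambda_k, phi_k), k >= 1, are
   represented here by lam (k-1), phi (k-1), i.e. index k :: nat starts at 0. *)

definition L2 :: "'a measure \<Rightarrow> ('a \<Rightarrow> real) \<Rightarrow> bool" where
  "L2 P0 f \<longleftrightarrow> f \<in> borel_measurable P0 \<and> integrable P0 (\<lambda>x. (f x)\<^sup>2)"

definition coef :: "'a measure \<Rightarrow> (nat \<Rightarrow> 'a \<Rightarrow> real) \<Rightarrow> ('a \<Rightarrow> real) \<Rightarrow> nat \<Rightarrow> real" where
  "coef P0 phi f k = (\<integral>x. f x * phi k x \<partial>P0)"

(* membership in the RKHS H(K), viewed inside L2(P0): mean-zero L2 functions with
   finite RKHS norm sum_k lambda_k^{-1} <f,phi_k>^2 *)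
definition in_RKHS :: "'a measure \<Rightarrow> (nat \<Rightarrow> real) \<Rightarrow> (nat \<Rightarrow> 'a \<Rightarrow> real) \<Rightarrow> ('a \<Rightarrow> real) \<Rightarrow> bool" where
  "in_RKHS P0 lam phi f \<longleftrightarrow> L2 P0 f \<and> (\<integral>x. f x \<partial>P0) = 0 \<and>
     summable (\<lambda>k. (coef P0 phi f k)\<^sup>2 / lam k)"

definition RKHS_norm :: "'a measure \<Rightarrow> (nat \<Rightarrow> real) \<Rightarrow> (nat \<Rightarrow> 'a \<Rightarrow> real) \<Rightarrow> ('a \<Rightarrow> real) \<Rightarrow> real" where
  "RKHS_norm P0 lam phi f = sqrt (\<Sum>k. (coef P0 phi f k)\<^sup>2 / lam k)"

definition F0 :: "'a measure \<Rightarrow> (nat \<Rightarrow> real) \<Rightarrow> (nat \<Rightarrow> 'a \<Rightarrow> real) \<Rightarrow> real \<Rightarrow> ('a \<Rightarrow> real) set" where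
  "F0 P0 lam phi M = {f. in_RKHS P0 lam phi f \<and> RKHS_norm P0 lam phi f \<le> M}"

definition udens :: "'a measure \<Rightarrow> 'a measure \<Rightarrow> 'a \<Rightarrow> real" where
  "udens P0 P x = enn2real (RN_deriv P0 P x) - 1"

definition chi2 :: "'a measure \<Rightarrow> 'a measure \<Rightarrow> real" where
  "chi2 P P0 = (\<integral>x. (udens P0 P x)\<^sup>2 \<partial>P0)"

definition Palt :: "'a measure \<Rightarrow> (nat \<Rightarrow> real) \<Rightarrow> (nat \<Rightarrow> 'a \<Rightarrow> real) \<Rightarrow> real \<Rightarrow> real \<Rightarrow> 'a measure set" where
  "Palt P0 lam phi \<Delta> M = {P. prob_space P \<and> sets P = sets P0 \<and> absolutely_continuous P0 P \<and>
      udens P0 P \<in> F0 P0 lam phi M \<and> chi2 P P0 \<ge> \<Delta>}"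

definition mmd_sq :: "(nat \<Rightarrow> real) \<Rightarrow> (nat \<Rightarrow> 'a \<Rightarrow> real) \<Rightarrow> nat \<Rightarrow> (nat \<Rightarrow> 'a) \<Rightarrow> real" where
  "mmd_sq lam phi n x = (\<Sum>k. lam k * ((1 / real n) * (\<Sum>i<n. phi k (x i)))\<^sup>2)"

definition std_normal_distribution :: "real measure" where
  "std_normal_distribution = density lborel (\<lambda>x. ennreal (std_normal_density x))"

definition Zseq :: "(nat \<Rightarrow> real) measure" where
  "Zseq = PiM UNIV (\<lambda>_. std_normal_distribution)"

definition Wvar :: "(nat \<Rightarrow> real) \<Rightarrow> (nat \<Rightarrow> real) \<Rightarrow> real" where
  "Wvar lam z = (\<Sum>k. lam k * (z k)\<^sup>2)"

definition q_w :: "(nat \<Rightarrow> real) \<Rightarrow> real \<Rightarrow> real" where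
  "q_w lam \<alpha> = Inf {t. measure Zseq {z \<in> space Zseq. Wvar lam z \<le> t} \<ge> 1 - \<alpha>}"

definition T_MMD :: "(nat \<Rightarrow> real) \<Rightarrow> (nat \<Rightarrow> 'a \<Rightarrow> real) \<Rightarrow> real \<Rightarrow> nat \<Rightarrow> (nat \<Rightarrow> 'a) \<Rightarrow> real" where
  "T_MMD lam phi \<alpha> n x = (if real n * mmd_sq lam phi n x > q_w lam \<alpha> then 1 else 0)"

(* beta(T_MMD; Delta, 0, M) at sample size n; the supremum over the empty class is 0 *)
definition typeII :: "'a measure \<Rightarrow> (nat \<Rightarrow> real) \<Rightarrow> (nat \<Rightarrow> 'a \<Rightarrow> real) \<Rightarrow> real \<Rightarrow> real \<Rightarrow> real \<Rightarrow> nat \<Rightarrow> real" where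
  "typeII P0 lam phi \<alpha> \<Delta> M n =
     Sup (insert 0 ((\<lambda>P. \<integral>x. 1 - T_MMD lam phi \<alpha> n x \<partial>(PiM {..<n} (\<lambda>_. P))) ` Palt P0 lam phi \<Delta> M))"

end

theory Submission
  imports Defs "HOL-Real_Asymp.Real_Asymp"
begin

text \<open>
  Write \<open>a\<^sub>k\<close> for the coefficients of \<open>u = dP/dP\<^sub>0 - 1\<close>, so that \<open>E\<^sub>P \<phi>\<^sub>k = a\<^sub>k\<close>.

  (i) Since \<open>\<Sum> a\<^sub>k\<^sup>2 / \<lambda>\<^sub>k \<le> M\<^sup>2\<close>, the Cauchy--Schwarz inequality gives \<open>\<Sum> \<lambda>\<^sub>k a\<^sub>k\<^sup>2 \<ge> \<Delta>\<^sup>2 / M\<^sup>2\<close>. Acceptance forces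
  the fluctuation \<open>n \<Sum> \<lambda>\<^sub>k (mean of \<phi>\<^sub>k(X\<^sub>i) - a\<^sub>k)\<^sup>2\<close> to be of order \<open>n \<Delta>\<^sup>2 / M\<^sup>2\<close>, while its
  expectation is bounded uniformly in \<open>P\<close>; Markov's inequality concludes.

  (ii) Take \<open>dP\<^sub>n/dP\<^sub>0 = 1 + a \<phi>\<^sub>\<kappa>\<close> with \<open>a\<^sup>2 = c\<^sub>0 n\<^sup>-\<^sup>1\<^sup>/\<^sup>2\<close> and \<open>\<lambda>\<^sub>\<kappa>\<close> of order \<open>c\<^sub>0 n\<^sup>-\<^sup>1\<^sup>/\<^sup>2 / M\<^sup>2\<close>, which adds only
  \<open>n \<lambda>\<^sub>\<kappa> a\<^sup>2 = O(c\<^sub>0\<^sup>2)\<close> to the statistic \<open>T\<close>. The acceptance probability is bounded below through Laplace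
  transforms, \<open>P(T \<le> q) \<ge> E exp (- \<tau> T) - exp (- \<tau> q)\<close>. Up to a small tail, \<open>E exp (- \<tau> T)\<close> converges to
  \<open>\<Prod> (1 + 2 \<tau> \<lambda>\<^sub>k)\<^sup>-\<^sup>1\<^sup>/\<^sup>2\<close>, and as \<open>\<Sum> \<lambda>\<^sub>k < \<infinity>\<close> this product exceeds \<open>exp (- \<tau> q)\<close> for large \<open>\<tau>\<close>.
  So no multivariate central limit theorem is needed, and \<open>\<alpha>\<close> may be arbitrarily close to \<open>1\<close>.
\<close>

section \<open>Sums of squares of i.i.d. sums\<close>

lemma integral_PiM_mult_components:
  fixes g :: "'a \<Rightarrow> real" and i j n :: nat
  assumes P: "prob_space P" and g: "integrable P g"
    and ij: "i \<noteq> j" "i < n" "j < n"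
  shows "(\<integral>x. g (x i) * g (x j) \<partial>PiM {..<n} (\<lambda>_. P)) = (\<integral>x. g x \<partial>P)\<^sup>2"
proof -
  interpret prob_space P by fact
  interpret PP: product_prob_space "\<lambda>_::nat. P" UNIV
    by unfold_locales
  \<comment> \<open>All other coordinates carry the constant factor 1, so that the product formula
    over all \<open>n\<close> coordinates applies.\<close>
  define f where "f l = (if l = i \<or> l = j then g else (\<lambda>_. 1))" for l
  have prod2: "(\<Prod>l<n. h l) = h i * h j" if "\<And>l. l \<noteq> i \<Longrightarrow> l \<noteq> j \<Longrightarrow> h l = 1" for h :: "nat \<Rightarrow> real"
  proof -
    have "(\<Prod>l<n. h l) = (\<Prod>l\<in>{i,j}. h l)"
      using that ij by (intro prod.mono_neutral_right) auto
    then show ?thesis using ij by simp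
  qed
  have "(\<integral>x. g (x i) * g (x j) \<partial>PiM {..<n} (\<lambda>_. P)) = (\<integral>x. (\<Prod>l<n. f l (x l)) \<partial>PiM {..<n} (\<lambda>_. P))"
    by (intro Bochner_Integration.integral_cong refl, subst prod2) (auto simp: f_def)
  also have "\<dots> = (\<Prod>l<n. \<integral>x. f l x \<partial>P)"
    using g by (intro PP.product_integral_prod) (auto simp: f_def)
  also have "\<dots> = (\<integral>x. g x \<partial>P)\<^sup>2"
    by (subst prod2) (auto simp: f_def prob_space power2_eq_square)
  finally show ?thesis .
qed

lemma space_PiM_component: "x \<in> space (PiM I (\<lambda>_. P)) \<Longrightarrow> i \<in> I \<Longrightarrow> x i \<in> space P"
  by (auto simp: space_PiM)

lemma abs_sum_PiM_le:
  fixes g :: "'a \<Rightarrow> real"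
  assumes "\<And>x. x \<in> space P \<Longrightarrow> \<bar>g x\<bar> \<le> B" and x: "x \<in> space (PiM {..<n} (\<lambda>_. P))"
  shows "\<bar>\<Sum>i<n. g (x i)\<bar> \<le> real n * B"
proof -
  have "\<bar>\<Sum>i<n. g (x i)\<bar> \<le> (\<Sum>i<n. B)"
    using assms space_PiM_component[OF x] by (intro order_trans[OF sum_abs] sum_mono) auto
  then show ?thesis by simp
qed

text \<open>Expanding the square leaves \<open>n\<close> diagonal terms of size at most
  \<open>B^2\<close>, while independence factors each off-diagonal term into the squared
  mean.\<close>

lemma integral_PiM_sum_square_le:
  fixes g :: "'a \<Rightarrow> real"
  assumes P: "prob_space P" and g[measurable]: "g \<in> borel_measurable P"
    and bdd: "\<And>x. x \<in> space P \<Longrightarrow> \<bar>g x\<bar> \<le> B"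
  shows "integrable (PiM {..<n} (\<lambda>_. P)) (\<lambda>x. (\<Sum>i<n. g (x i))\<^sup>2)"
    and "(\<integral>x. (\<Sum>i<n. g (x i))\<^sup>2 \<partial>PiM {..<n} (\<lambda>_. P))
      \<le> real n * B\<^sup>2 + (real n * (\<integral>x. g x \<partial>P))\<^sup>2"
proof -
  interpret prob_space P by fact
  interpret Q: prob_space "PiM {..<n} (\<lambda>_. P)"
    by (intro prob_space_PiM P)
  have gint: "integrable P g"
    by (rule integrable_const_bound[where B = B]) (auto intro!: AE_I2 bdd)
  have gx: "\<bar>g (x i)\<bar> \<le> B" if "x \<in> space (PiM {..<n} (\<lambda>_. P))" "i < n" for x i
    using bdd space_PiM_component[OF that(1), of i] that by auto
  have int_ij: "integrable (PiM {..<n} (\<lambda>_. P)) (\<lambda>x. g (x i) * g (x j))" if "i < n" "j < n" for i j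
    using that by (intro Q.integrable_const_bound[where B = "B * B"] AE_I2)
       (auto simp: abs_mult intro!: mult_mono gx order_trans[OF abs_ge_zero gx])
  have sq: "(\<Sum>i<n. g (x i))\<^sup>2 = (\<Sum>i<n. \<Sum>j<n. g (x i) * g (x j))" for x
    by (simp add: power2_eq_square sum_product)
  show "integrable (PiM {..<n} (\<lambda>_. P)) (\<lambda>x. (\<Sum>i<n. g (x i))\<^sup>2)"
    unfolding sq by (intro Bochner_Integration.integrable_sum int_ij) auto
  define m where "m = (\<integral>x. g x \<partial>P)"
  have diag: "(\<integral>x. g (x i) * g (x i) \<partial>PiM {..<n} (\<lambda>_. P)) \<le> B\<^sup>2" if "i < n" for i
  proof -
    have "(\<integral>x. g (x i) * g (x i) \<partial>PiM {..<n} (\<lambda>_. P)) \<le> (\<integral>x. B\<^sup>2 \<partial>PiM {..<n} (\<lambda>_. P))"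
      using that gx[of _ i] by (intro integral_mono int_ij)
        (auto simp: power2_eq_square[symmetric] intro: abs_le_square_iff[THEN iffD1] order_trans[OF _ abs_ge_self])
    then show ?thesis by (simp add: Q.prob_space)
  qed
  have "(\<integral>x. (\<Sum>i<n. g (x i))\<^sup>2 \<partial>PiM {..<n} (\<lambda>_. P))
      = (\<Sum>i<n. \<Sum>j<n. \<integral>x. g (x i) * g (x j) \<partial>PiM {..<n} (\<lambda>_. P))"
    unfolding sq using int_ij
    by (subst Bochner_Integration.integral_sum, force)
       (intro sum.cong refl Bochner_Integration.integral_sum, auto)
  \<comment> \<open>The diagonal also receives \<open>m^2\<close>; this overcount is harmless and
    makes the double sum explicit.\<close>
  also have "\<dots> \<le> (\<Sum>i<n. \<Sum>j<n. (if j = i then B\<^sup>2 else 0) + m\<^sup>2)"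
    using diag integral_PiM_mult_components[OF P gint, of _ _ n]
    by (intro sum_mono) (auto simp: m_def intro: add_increasing2)
  also have "\<dots> = real n * B\<^sup>2 + (real n * m)\<^sup>2"
    by (simp add: sum.distrib power2_eq_square algebra_simps)
  finally show "(\<integral>x. (\<Sum>i<n. g (x i))\<^sup>2 \<partial>PiM {..<n} (\<lambda>_. P))
      \<le> real n * B\<^sup>2 + (real n * (\<integral>x. g x \<partial>P))\<^sup>2" by (simp add: m_def)
qed

text \<open>Boundedness supplies the deterministic majorant \<open>w k * (real n * B)^2\<close>,
  which yields summability at every sample point and the exchange of sum and integral. It serves the
  centred eigenfunctions, the eigenfunctions themselves, and their tails from an index
  \<open>N\<close> on.\<close>

lemma weighted_sum_square_PiM:
  fixes g :: "nat \<Rightarrow> 'a \<Rightarrow> real" and w :: "nat \<Rightarrow> real"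
  assumes P: "prob_space P" and g[measurable]: "\<And>k. g k \<in> borel_measurable P"
    and bdd: "\<And>k x. x \<in> space P \<Longrightarrow> \<bar>g k x\<bar> \<le> B"
    and w: "\<And>k. 0 \<le> w k" "summable w"
  shows "\<And>x. x \<in> space (PiM {..<n} (\<lambda>_. P)) \<Longrightarrow> summable (\<lambda>k. w k * (\<Sum>i<n. g k (x i))\<^sup>2)"
    and "integrable (PiM {..<n} (\<lambda>_. P)) (\<lambda>x. \<Sum>k. w k * (\<Sum>i<n. g k (x i))\<^sup>2)"
    and "(\<integral>x. (\<Sum>k. w k * (\<Sum>i<n. g k (x i))\<^sup>2) \<partial>PiM {..<n} (\<lambda>_. P))
      \<le> (\<Sum>k. w k * (real n * B\<^sup>2 + (real n * (\<integral>x. g k x \<partial>P))\<^sup>2))"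
proof -
  interpret prob_space P by fact
  let ?Q = "PiM {..<n} (\<lambda>_. P)"
  interpret Q: prob_space ?Q
    by (intro prob_space_PiM P)
  let ?f = "\<lambda>k x. w k * (\<Sum>i<n. g k (x i))\<^sup>2"
  have fb: "norm (?f k x) \<le> w k * (real n * B)\<^sup>2" if "x \<in> space ?Q" for k x
  proof -
    have "\<bar>\<Sum>i<n. g k (x i)\<bar> \<le> real n * B"
      using that bdd by (intro abs_sum_PiM_le[of P]) auto
    then have "(\<Sum>i<n. g k (x i))\<^sup>2 \<le> (real n * B)\<^sup>2"
      by (metis abs_ge_zero power2_abs power_mono)
    then show ?thesis using w(1)[of k] by (auto simp: abs_mult intro: mult_left_mono)
  qed
  have sw: "summable (\<lambda>k. w k * c)" for c
    using w(2) by (rule summable_mult2)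
  show sm: "summable (\<lambda>k. ?f k x)" if "x \<in> space ?Q" for x
    by (rule summable_comparison_test[OF _ sw]) (use fb[OF that] in blast)
  have fi: "integrable ?Q (?f k)" for k
    using integral_PiM_sum_square_le(1)[OF P g[of k] bdd, of n] by simp
  have smn: "AE x in ?Q. summable (\<lambda>k. norm (?f k x))"
    by (intro AE_I2) (use sm w in \<open>simp add: abs_mult\<close>)
  have sint: "summable (\<lambda>k. \<integral>x. norm (?f k x) \<partial>?Q)"
  proof (rule summable_comparison_test[OF _ sw[of "(real n * B)\<^sup>2"]], intro exI allI impI)
    fix k
    have "(\<integral>x. norm (?f k x) \<partial>?Q) \<le> (\<integral>x. w k * (real n * B)\<^sup>2 \<partial>?Q)"
      using fi fb by (intro integral_mono) auto
    then show "norm (\<integral>x. norm (?f k x) \<partial>?Q) \<le> w k * (real n * B)\<^sup>2"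
      by (simp add: Q.prob_space)
  qed
  show "integrable ?Q (\<lambda>x. \<Sum>k. ?f k x)"
    by (rule integrable_suminf[OF fi smn sint])
  have mb: "\<bar>\<integral>x. g k x \<partial>P\<bar> \<le> B" for k
  proof -
    have "integrable P (g k)"
      by (rule integrable_const_bound[where B = B]) (auto intro!: AE_I2 bdd)
    then have "(\<integral>x. \<bar>g k x\<bar> \<partial>P) \<le> (\<integral>x. B \<partial>P)"
      by (intro integral_mono) (auto simp: bdd)
    then have "\<bar>\<integral>x. g k x \<partial>P\<bar> \<le> (\<integral>x. B \<partial>P)"
      by (rule order_trans[OF integral_abs_bound])
    then show ?thesis by (simp add: prob_space)
  qed
  have "summable (\<lambda>k. w k * (real n * B\<^sup>2 + (real n * (\<integral>x. g k x \<partial>P))\<^sup>2))"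
  proof (rule summable_comparison_test[OF _ sw[of "real n * B\<^sup>2 + (real n * B)\<^sup>2"]], intro exI allI impI)
    fix k
    have "(real n * (\<integral>x. g k x \<partial>P))\<^sup>2 \<le> (real n * B)\<^sup>2"
      using mb[of k] by (intro abs_le_square_iff[THEN iffD1]) (auto simp: abs_mult intro!: mult_left_mono)
    then show "norm (w k * (real n * B\<^sup>2 + (real n * (\<integral>x. g k x \<partial>P))\<^sup>2)) \<le> w k * (real n * B\<^sup>2 + (real n * B)\<^sup>2)"
      using w(1)[of k] by (auto simp: abs_mult intro!: mult_left_mono)
  qed
  moreover have "summable (\<lambda>k. \<integral>x. ?f k x \<partial>?Q)"
    using w by (intro summable_norm_cancel[OF summable_comparison_test[OF _ sint]] exI allI impI)
       (simp add: abs_mult)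
  moreover have "(\<integral>x. ?f k x \<partial>?Q) \<le> w k * (real n * B\<^sup>2 + (real n * (\<integral>x. g k x \<partial>P))\<^sup>2)" for k
    using integral_PiM_sum_square_le(2)[OF P g[of k] bdd, of n] w(1)[of k] by (auto intro!: mult_left_mono)
  ultimately have "(\<Sum>k. \<integral>x. ?f k x \<partial>?Q) \<le> (\<Sum>k. w k * (real n * B\<^sup>2 + (real n * (\<integral>x. g k x \<partial>P))\<^sup>2))"
    by (intro suminf_le)
  moreover have "(\<integral>x. (\<Sum>k. ?f k x) \<partial>?Q) = (\<Sum>k. \<integral>x. ?f k x \<partial>?Q)"
    by (rule integral_suminf[OF fi smn sint])
  ultimately show "(\<integral>x. (\<Sum>k. ?f k x) \<partial>?Q) \<le> (\<Sum>k. w k * (real n * B\<^sup>2 + (real n * (\<integral>x. g k x \<partial>P))\<^sup>2))"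
    by simp
qed

section \<open>Laplace transforms of quadratic forms\<close>

lemma prob_space_std_normal: "prob_space std_normal_distribution"
  unfolding std_normal_distribution_def by (rule prob_space_normal_density) simp

lemma sets_std_normal[simp, measurable_cong]: "sets std_normal_distribution = sets borel"
  and space_std_normal[simp]: "space std_normal_distribution = UNIV"
  by (simp_all add: std_normal_distribution_def)

lemma char_std_normal: "char std_normal_distribution t = exp (- (t\<^sup>2) / 2)"
  using char_std_normal_distribution by (simp add: std_normal_distribution_def)

text \<open>The product of the integrand with the standard normal density is \<sigma> times the
  centred normal density of variance \<open>1 / (1 + 2 * c)\<close>, where \<sigma> is its standard
  deviation.\<close>

lemma integral_std_normal_exp_neg_square:
  assumes "0 \<le> c"
  shows "(\<integral>z. exp (- c * z\<^sup>2) \<partial>std_normal_distribution) = 1 / sqrt (1 + 2 * c)"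
proof -
  define \<sigma> where "\<sigma> = 1 / sqrt (1 + 2 * c)"
  have \<sigma>: "0 < \<sigma>" "\<sigma>\<^sup>2 = 1 / (1 + 2 * c)"
    using assms by (auto simp: \<sigma>_def power_divide)
  have e: "std_normal_density z * exp (- c * z\<^sup>2) = \<sigma> * normal_density 0 \<sigma> z" for z
  proof -
    have "- (z\<^sup>2 / 2) - c * z\<^sup>2 = - z\<^sup>2 / (2 * \<sigma>\<^sup>2)"
      using assms unfolding \<sigma>(2) by (simp add: field_simps)
    moreover have "sqrt (2 * pi * \<sigma>\<^sup>2) = sqrt (2 * pi) * \<sigma>"
      using \<sigma>(1) by (simp add: real_sqrt_mult)
    ultimately show ?thesis
      using \<sigma>(1) by (simp add: normal_density_def exp_add[symmetric] field_simps)
  qed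
  have "(\<integral>z. exp (- c * z\<^sup>2) \<partial>std_normal_distribution)
      = (\<integral>z. std_normal_density z * exp (- c * z\<^sup>2) \<partial>lborel)"
    unfolding std_normal_distribution_def by (subst integral_density) auto
  also have "\<dots> = \<sigma>"
    unfolding e using \<sigma>(1) by simp
  finally show ?thesis by (simp add: \<sigma>_def)
qed

text \<open>Read from right to left, this turns the exponential of a negative quadratic form in
  \<open>b\<close> into a Gaussian average of phases that are linear in \<open>b\<close>.\<close>

lemma integral_PiM_std_normal_iexp:
  fixes b :: "nat \<Rightarrow> real"
  shows "(\<integral>z. iexp (\<Sum>k<N. b k * z k) \<partial>PiM {..<N} (\<lambda>_. std_normal_distribution))
    = of_real (exp (- (\<Sum>k<N. (b k)\<^sup>2) / 2))"
proof -
  interpret N: prob_space std_normal_distribution by (rule prob_space_std_normal)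
  interpret product_prob_space "\<lambda>_::nat. std_normal_distribution" UNIV
    by unfold_locales
  have "(\<integral>z. iexp (\<Sum>k<N. b k * z k) \<partial>PiM {..<N} (\<lambda>_. std_normal_distribution))
    = (\<integral>z. (\<Prod>k<N. iexp (b k * z k)) \<partial>PiM {..<N} (\<lambda>_. std_normal_distribution))"
    by (simp add: exp_sum sum_distrib_left)
  also have "\<dots> = (\<Prod>k<N. \<integral>x. iexp (b k * x) \<partial>std_normal_distribution)"
    by (intro product_integral_prod) (auto intro!: N.integrable_const_bound[where B = 1])
  also have "\<dots> = (\<Prod>k<N. of_real (exp (- ((b k)\<^sup>2) / 2)))"
    using char_std_normal unfolding char_def by simp
  also have "\<dots> = of_real (exp (- (\<Sum>k<N. (b k)\<^sup>2) / 2))"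
    by (simp add: exp_sum[symmetric] sum_divide_distrib sum_negf flip: of_real_prod)
  finally show ?thesis .
qed

text \<open>For \<open>c k = \<tau> * lam k\<close> this is the Laplace transform at \<tau> of the
  first \<open>N\<close> terms of \<open>Wvar lam\<close>.\<close>

lemma integral_PiM_std_normal_exp_neg:
  fixes c :: "nat \<Rightarrow> real"
  assumes "\<And>k. 0 \<le> c k"
  shows "(\<integral>z. exp (- (\<Sum>k<N. c k * (z k)\<^sup>2)) \<partial>PiM {..<N} (\<lambda>_. std_normal_distribution))
    = (\<Prod>k<N. 1 / sqrt (1 + 2 * c k))"
proof -
  interpret N: prob_space std_normal_distribution by (rule prob_space_std_normal)
  interpret product_prob_space "\<lambda>_::nat. std_normal_distribution" UNIV
    by unfold_locales
  have "(\<integral>z. exp (- (\<Sum>k<N. c k * (z k)\<^sup>2)) \<partial>PiM {..<N} (\<lambda>_. std_normal_distribution))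
    = (\<integral>z. (\<Prod>k<N. exp (- c k * (z k)\<^sup>2)) \<partial>PiM {..<N} (\<lambda>_. std_normal_distribution))"
    by (simp add: exp_sum[symmetric] sum_negf)
  also have "\<dots> = (\<Prod>k<N. \<integral>x. exp (- c k * x\<^sup>2) \<partial>std_normal_distribution)"
    using assms by (intro product_integral_prod) (auto intro!: N.integrable_const_bound[where B = 1])
  finally show ?thesis
    by (simp only: integral_std_normal_exp_neg_square[OF assms])
qed

text \<open>Gaussian linearisation: the square in the exponent is the characteristic function of a standard
  normal vector, so after exchanging the integrals the sample enters only through an i.i.d. product.\<close>
lemma laplace_PiM_sum_square:
  fixes g :: "nat \<Rightarrow> 'a \<Rightarrow> real"
  assumes P: "prob_space P" and g[measurable]: "\<And>k. g k \<in> borel_measurable P"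
  shows "complex_of_real (\<integral>x. exp (- (t\<^sup>2 * (\<Sum>k<N. (\<Sum>i<n. g k (x i))\<^sup>2)) / 2) \<partial>PiM {..<n} (\<lambda>_. P))
    = (\<integral>z. char (distr P borel (\<lambda>x. \<Sum>k<N. z k * g k x)) t ^ n
        \<partial>PiM {..<N} (\<lambda>_. std_normal_distribution))"
proof -
  let ?Q = "PiM {..<n} (\<lambda>_. P)" and ?Z = "PiM {..<N} (\<lambda>_. std_normal_distribution)"
  interpret P: prob_space P by fact
  interpret PP: product_prob_space "\<lambda>_::nat. P" UNIV by unfold_locales
  interpret Q: prob_space ?Q by (intro prob_space_PiM P)
  interpret Z: prob_space ?Z by (intro prob_space_PiM prob_space_std_normal)
  interpret QZ: pair_prob_space ?Q ?Z ..
  let ?e = "\<lambda>x z. iexp (\<Sum>k<N. (t * (\<Sum>i<n. g k (x i))) * z k)"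
  have meas: "(\<lambda>(x, z). ?e x z) \<in> borel_measurable (?Q \<Otimes>\<^sub>M ?Z)"
    by measurable
  have int: "integrable (?Q \<Otimes>\<^sub>M ?Z) (\<lambda>(x, z). ?e x z)"
    using meas by (rule QZ.P.integrable_const_bound[where B = 1, rotated]) (auto intro!: AE_I2)
  have "complex_of_real (\<integral>x. exp (- (t\<^sup>2 * (\<Sum>k<N. (\<Sum>i<n. g k (x i))\<^sup>2)) / 2) \<partial>?Q)
    = (\<integral>x. complex_of_real (exp (- (t\<^sup>2 * (\<Sum>k<N. (\<Sum>i<n. g k (x i))\<^sup>2)) / 2)) \<partial>?Q)"
    by (rule integral_complex_of_real[symmetric])
  \<comment> \<open>For a fixed sample, \<open>t\<close> times the vector of the \<open>N\<close>
    sample sums plays the role of the argument \<open>b\<close> of the Gaussian characteristic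
    function.\<close>
  also have "\<dots> = (\<integral>x. (\<integral>z. ?e x z \<partial>?Z) \<partial>?Q)"
    by (intro Bochner_Integration.integral_cong refl, subst integral_PiM_std_normal_iexp)
       (simp add: power_mult_distrib sum_distrib_left[where r = "t\<^sup>2"])
  also have "\<dots> = (\<integral>z. (\<integral>x. ?e x z \<partial>?Q) \<partial>?Z)"
    by (rule QZ.Fubini_integral[OF int, symmetric])
  also have "\<dots> = (\<integral>z. char (distr P borel (\<lambda>x. \<Sum>k<N. z k * g k x)) t ^ n \<partial>?Z)"
  proof (intro Bochner_Integration.integral_cong refl)
    fix z
    let ?h = "\<lambda>x. \<Sum>k<N. z k * g k x"
    \<comment> \<open>For fixed \<open>z\<close> the phase is a sum over the sample of one function
      \<open>?h\<close>; independence then gives \<open>n\<close> equal factors.\<close>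
    have "(\<Sum>k<N. (t * (\<Sum>i<n. g k (x i))) * z k) = (\<Sum>i<n. t * ?h (x i))" for x
      by (simp add: sum_distrib_left sum_distrib_right mult_ac sum.swap[of _ "{..<n}"])
    then have "(\<integral>x. ?e x z \<partial>?Q) = (\<integral>x. (\<Prod>i<n. iexp (t * ?h (x i))) \<partial>?Q)"
      by (simp add: exp_sum sum_distrib_left)
    also have "\<dots> = (\<Prod>i<n. \<integral>x. iexp (t * ?h x) \<partial>P)"
      by (intro PP.product_integral_prod) (auto intro!: P.integrable_const_bound[where B = 1])
    also have "(\<integral>x. iexp (t * ?h x) \<partial>P) = char (distr P borel ?h) t"
      unfolding char_def by (subst integral_distr) auto
    finally show "(\<integral>x. ?e x z \<partial>?Q) = char (distr P borel ?h) t ^ n"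
      by simp
  qed
  finally show ?thesis .
qed

text \<open>A quantitative central limit step: one factor differs from
  \<open>1 - v / 2 / real n\<close> by \<open>1 / real n\<close> times the stated error, and taking
  \<open>n\<close>-th powers on the closed unit disc multiplies distances by at most
  \<open>n\<close>. The bound \<open>v \<le> 4 * real n\<close> keeps the second base in that disc.
  The number \<open>v\<close> need not be the variance of \<open>h\<close>, since the law of the
  sample will vary with \<open>n\<close>.\<close>

lemma char_power_diff_le:
  fixes h :: "'a \<Rightarrow> real"
  assumes P: "prob_space P" and h[measurable]: "h \<in> borel_measurable P"
    and bdd: "\<And>x. x \<in> space P \<Longrightarrow> \<bar>h x\<bar> \<le> B"
    and mean: "(\<integral>x. h x \<partial>P) = 0" and n: "0 < n" and v: "0 \<le> v" "v \<le> 4 * real n"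
  shows "norm (char (distr P borel h) (1 / sqrt (real n)) ^ n - of_real ((1 - v / 2 / real n) ^ n))
    \<le> B ^ 3 / (6 * sqrt (real n)) + \<bar>(\<integral>x. (h x)\<^sup>2 \<partial>P) - v\<bar> / 2"
proof -
  interpret prob_space P by fact
  have hi: "integrable P h"
    by (rule integrable_const_bound[where B = B]) (auto intro!: AE_I2 bdd)
  have h2: "(h x)\<^sup>2 \<le> B\<^sup>2" if "x \<in> space P" for x
    using bdd[OF that] by (metis abs_ge_zero power2_abs power_mono)
  have h3: "\<bar>h x\<bar> ^ 3 \<le> B ^ 3" if "x \<in> space P" for x
    using bdd[OF that] by (intro power_mono) auto
  have hi2: "integrable P (\<lambda>x. (h x)\<^sup>2)"
    by (rule integrable_const_bound[where B = "B\<^sup>2"]) (auto intro!: AE_I2 h2)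
  define \<sigma>2 where "\<sigma>2 = (\<integral>x. (h x)\<^sup>2 \<partial>P)"
  let ?t = "1 / sqrt (real n)"
  let ?c = "char (distr P borel h) ?t"
  have t2: "?t\<^sup>2 = 1 / real n" by (simp add: power_divide)
  interpret D: real_distribution "distr P borel h" by (intro real_distribution_distr) auto
  have "cmod (?c - (1 - ?t\<^sup>2 * \<sigma>2 / 2))
      \<le> ?t\<^sup>2 / 6 * expectation (\<lambda>x. min (6 * (h x)\<^sup>2) (\<bar>?t\<bar> * \<bar>h x\<bar>^3))"
    by (rule char_approx3'[OF h hi hi2 mean _ refl]) (simp add: mean \<sigma>2_def)
  \<comment> \<open>The cubic branch of the minimum is taken; it supplies the additional factor
    \<open>1 / sqrt (real n)\<close>.\<close>
  also have "\<dots> \<le> ?t\<^sup>2 / 6 * expectation (\<lambda>x. ?t * B ^ 3)"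
    using n h3 hi2
    by (intro mult_left_mono integral_mono)
       (auto intro!: min.coboundedI2 divide_right_mono integrable_const_bound[where B = "6 * B\<^sup>2"] AE_I2 
          order_trans[OF _ mult_left_mono[OF h2]])
  finally have 1: "cmod (?c - (1 - ?t\<^sup>2 * \<sigma>2 / 2)) \<le> 1 / real n * (B ^ 3 / (6 * sqrt (real n)))"
    unfolding t2 by (simp add: prob_space)
  have 2: "cmod (complex_of_real (1 - ?t\<^sup>2 * \<sigma>2 / 2) - of_real (1 - v / 2 / real n)) = 1 / real n * (\<bar>\<sigma>2 - v\<bar> / 2)"
  proof -
    have "(1 - ?t\<^sup>2 * \<sigma>2 / 2) - (1 - v / 2 / real n) = - (1 / real n * ((\<sigma>2 - v) / 2))"
      unfolding t2 using n by (simp add: field_simps)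
    then have "complex_of_real (1 - ?t\<^sup>2 * \<sigma>2 / 2) - complex_of_real (1 - v / 2 / real n) = of_real (- (1 / real n * ((\<sigma>2 - v) / 2)))"
      by (metis of_real_1 of_real_diff)
    also have "cmod \<dots> = 1 / real n * (\<bar>\<sigma>2 - v\<bar> / 2)"
      by (subst norm_of_real) (simp add: abs_mult)
    finally show ?thesis .
  qed
  have "norm (?c ^ n - of_real (1 - v / 2 / real n) ^ n) \<le> real n * cmod (?c - of_real (1 - v / 2 / real n))"
    using v n by (intro norm_power_diff D.cmod_char_le_1)
       (simp only: norm_of_real, auto simp: abs_le_iff field_simps)
  also have "\<dots> \<le> real n * (1 / real n * (B ^ 3 / (6 * sqrt (real n))) + 1 / real n * (\<bar>\<sigma>2 - v\<bar> / 2))"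
    by (intro mult_left_mono order_trans[OF dist_triangle[of _ _ "complex_of_real (1 - ?t\<^sup>2 * \<sigma>2 / 2)", unfolded dist_norm]
          add_mono[OF 1 eq_refl[OF 2]]]) simp
  also have "\<dots> = B ^ 3 / (6 * sqrt (real n)) + \<bar>\<sigma>2 - v\<bar> / 2"
    using n by (simp add: distrib_left)
  finally show ?thesis by (simp add: \<sigma>2_def)
qed

lemma char_linear_measurable:
  fixes g :: "nat \<Rightarrow> 'a \<Rightarrow> real"
  assumes P: "prob_space P" and g[measurable]: "\<And>k. g k \<in> borel_measurable P"
  shows "(\<lambda>z. char (distr P borel (\<lambda>x. \<Sum>k<N. z k * g k x)) t)
    \<in> borel_measurable (PiM {..<N} (\<lambda>_. std_normal_distribution))"
proof -
  interpret prob_space P by fact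
  have "char (distr P borel (\<lambda>x. \<Sum>k<N. z k * g k x)) t = (\<integral>x. iexp (t * (\<Sum>k<N. z k * g k x)) \<partial>P)" for z
    unfolding char_def by (subst integral_distr) auto
  then show ?thesis by simp
qed

section \<open>The critical value and the eigenvalues\<close>

text \<open>Almost surely \<open>Wvar\<close> dominates its first term, a positive multiple of a
  squared normal variable, which has no atom at 0. Strict positivity is what separates
  \<open>exp (- \<tau> * q / 2)\<close> from \<open>exp (- \<tau> * q)\<close> in the lower
  bound.\<close>

lemma q_w_pos:
  assumes lam: "\<And>k. 0 < lam k" "summable lam" and \<alpha>: "0 < \<alpha>" "\<alpha> < 1"
  shows "0 < q_w lam \<alpha>"
proof -
  interpret Z: prob_space Zseq
    unfolding Zseq_def by (intro prob_space_PiM prob_space_std_normal)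
  interpret N: prob_space std_normal_distribution by (rule prob_space_std_normal)
  have [measurable_cong]: "sets Zseq = sets (PiM UNIV (\<lambda>_. borel))"
    unfolding Zseq_def by (intro sets_PiM_cong) auto
  have W[measurable]: "Wvar lam \<in> borel_measurable Zseq"
    unfolding Wvar_def[abs_def] by measurable
  have distr: "distr Zseq std_normal_distribution (\<lambda>z. z k) = std_normal_distribution" for k
    unfolding Zseq_def by (rule distr_PiM_component) (auto intro: prob_space_std_normal)
  define m where "m = (\<integral>\<^sup>+z. ennreal (z\<^sup>2) \<partial>std_normal_distribution)"
  have m: "m < \<infinity>"
  proof -
    have "integrable std_normal_distribution (\<lambda>z. z ^ (2 * 1))"
      using integrable_std_normal_distribution_moment[of "2 * 1"] by (simp add: std_normal_distribution_def)
    then show ?thesis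
      by (simp add: integrable_iff_bounded m_def)
  qed
  have mk: "(\<integral>\<^sup>+z. ennreal ((z k)\<^sup>2) \<partial>Zseq) = m" for k
  proof -
    have "m = (\<integral>\<^sup>+z. ennreal (z\<^sup>2) \<partial>distr Zseq std_normal_distribution (\<lambda>z. z k))"
      by (simp only: m_def distr)
    also have "\<dots> = (\<integral>\<^sup>+z. ennreal ((z k)\<^sup>2) \<partial>Zseq)"
      by (rule nn_integral_distr) measurable
    finally show ?thesis by simp
  qed
  \<comment> \<open>A real \<open>suminf\<close> says nothing where the series diverges. The
    expectation is therefore computed in \<open>ennreal\<close> first, and its finiteness gives
    almost sure summability.\<close>
  have "(\<integral>\<^sup>+z. (\<Sum>k. ennreal (lam k * (z k)\<^sup>2)) \<partial>Zseq) = (\<Sum>k. \<integral>\<^sup>+z. ennreal (lam k * (z k)\<^sup>2) \<partial>Zseq)"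
    by (rule nn_integral_suminf) measurable
  also have "\<dots> = (\<Sum>k. ennreal (lam k) * m)"
  proof (intro suminf_cong)
    fix k
    have "(\<integral>\<^sup>+z. ennreal (lam k * (z k)\<^sup>2) \<partial>Zseq) = (\<integral>\<^sup>+z. ennreal (lam k) * ennreal ((z k)\<^sup>2) \<partial>Zseq)"
      using lam(1)[of k] by (simp add: ennreal_mult)
    also have "\<dots> = ennreal (lam k) * (\<integral>\<^sup>+z. ennreal ((z k)\<^sup>2) \<partial>Zseq)"
      by (rule nn_integral_cmult) measurable
    finally show "(\<integral>\<^sup>+z. ennreal (lam k * (z k)\<^sup>2) \<partial>Zseq) = ennreal (lam k) * m"
      by (simp only: mk)
  qed
  also have "\<dots> = (\<Sum>k. ennreal (lam k)) * m"
    by (rule ennreal_suminf_multc)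
  also have "\<dots> = ennreal (suminf lam) * m"
    using suminf_ennreal_eq[OF less_imp_le[OF lam(1)] summable_sums[OF lam(2)]] by (simp only:)
  also have "\<dots> < \<infinity>"
    using m by (simp add: ennreal_mult_less_top)
  finally have "AE z in Zseq. (\<Sum>k. ennreal (lam k * (z k)\<^sup>2)) \<noteq> \<infinity>"
    by (intro nn_integral_PInf_AE) auto
  then have ge: "AE z in Zseq. lam 0 * (z 0)\<^sup>2 \<le> Wvar lam z"
  proof eventually_elim
    case (elim z)
    then have "summable (\<lambda>k. lam k * (z k)\<^sup>2)"
      using lam(1) by (intro summable_suminf_not_top) (auto simp: less_imp_le)
    then have "(\<Sum>k\<in>{0}. lam k * (z k)\<^sup>2) \<le> Wvar lam z"
      unfolding Wvar_def using lam(1) by (intro sum_le_suminf) (auto simp: less_imp_le)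
    then show ?case by simp
  qed
  let ?A = "\<lambda>t. {z. lam 0 * z\<^sup>2 \<le> t}"
  have P_le: "measure Zseq {z \<in> space Zseq. Wvar lam z \<le> t} \<le> measure std_normal_distribution (?A t)" for t
  proof -
    have "measure Zseq {z \<in> space Zseq. Wvar lam z \<le> t} \<le> measure Zseq {z \<in> space Zseq. lam 0 * (z 0)\<^sup>2 \<le> t}"
      using ge by (intro Z.finite_measure_mono_AE) auto
    also have "\<dots> = measure (distr Zseq std_normal_distribution (\<lambda>z. z 0)) (?A t)"
      by (subst measure_distr) (auto intro!: arg_cong[where f = "measure Zseq"])
    finally show ?thesis by (simp add: distr)
  qed
  have "(\<lambda>n. measure std_normal_distribution (?A (1 / real (Suc n))))
      \<longlonglongrightarrow> measure std_normal_distribution (\<Inter>n. ?A (1 / real (Suc n)))"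
  proof (rule N.finite_Lim_measure_decseq)
    show "decseq (\<lambda>n. ?A (1 / real (Suc n)))"
      by (intro decseq_SucI Collect_mono impI) (erule order_trans, simp add: frac_le)
  qed auto
  also have "(\<Inter>n. ?A (1 / real (Suc n))) = {0}"
  proof (intro equalityI subsetI)
    fix z assume z: "z \<in> (\<Inter>n. ?A (1 / real (Suc n)))"
    have "lam 0 * z\<^sup>2 \<le> 0"
      by (rule LIMSEQ_le_const[OF LIMSEQ_Suc[OF lim_1_over_n]]) (use z in auto)
    then show "z \<in> {0}" using lam(1)[of 0] by (auto simp: mult_le_0_iff)
  qed auto
  also have "measure std_normal_distribution {0} = 0"
    unfolding std_normal_distribution_def measure_def
    by (subst emeasure_density) (auto simp: nn_integral_0_iff_AE intro!: AE_I[where N = "{0}"] split: split_indicator)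
  finally have "\<forall>\<^sub>F n in sequentially. measure std_normal_distribution (?A (1 / real (Suc n))) < 1 - \<alpha>"
    using \<alpha> by (intro order_tendstoD) auto
  then obtain n where n: "measure std_normal_distribution (?A (1 / real (Suc n))) < 1 - \<alpha>"
    by (auto simp: eventually_sequentially)
  let ?S = "{t. measure Zseq {z \<in> space Zseq. Wvar lam z \<le> t} \<ge> 1 - \<alpha>}"
  have "1 / real (Suc n) \<le> t" if "t \<in> ?S" for t
  proof (rule ccontr)
    assume "\<not> 1 / real (Suc n) \<le> t"
    then have "measure std_normal_distribution (?A t) \<le> measure std_normal_distribution (?A (1 / real (Suc n)))"
      by (intro N.finite_measure_mono) auto
    then show False using that n P_le[of t] by simp
  qed
  \<comment> \<open>A lower bound on the elements passes to the real \<open>Inf\<close> only for a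
    nonempty set.\<close>
  moreover have "?S \<noteq> {}"
  proof -
    interpret D: real_distribution "distr Zseq borel (Wvar lam)"
      by (intro Z.real_distribution_distr) auto
    have "\<forall>\<^sub>F t in at_top. 1 - \<alpha> < cdf (distr Zseq borel (Wvar lam)) t"
      using D.cdf_lim_at_top_prob \<alpha> by (intro order_tendstoD) auto
    then obtain t where "1 - \<alpha> < cdf (distr Zseq borel (Wvar lam)) t"
      by (auto simp: eventually_at_top_linorder)
    also have "\<dots> = measure Zseq {z \<in> space Zseq. Wvar lam z \<le> t}"
      unfolding cdf_def by (subst measure_distr) (auto intro!: arg_cong[where f = "measure Zseq"])
    finally have "t \<in> ?S" by simp
    then show ?thesis by blast
  qed
  ultimately have "1 / real (Suc n) \<le> Inf ?S"
    by (intro cInf_greatest)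
  then have "1 / real (Suc n) \<le> q_w lam \<alpha>"
    unfolding q_w_def .
  then show ?thesis by (rule less_le_trans[rotated]) simp
qed

text \<open>By dominated convergence \<open>(\<Sum>k. ln (1 + 2 * \<tau> * lam k)) / \<tau>\<close> tends to \<open>0\<close>, so the Laplace
  transform of \<open>W\<close> decays slower than every exponential.\<close>
lemma exists_laplace_prod_ge:
  fixes lam :: "nat \<Rightarrow> real"
  assumes lam: "\<And>k. 0 \<le> lam k" "summable lam" and q: "0 < q"
  shows "\<exists>\<tau>>0. \<forall>N. exp (- \<tau> * q / 2) \<le> (\<Prod>k<N. 1 / sqrt (1 + 2 * (\<tau> * lam k)))"
proof -
  \<comment> \<open>The bound \<open>\<tau> * q / 2\<close> is shared equally: the terms from
    \<open>m\<close> on are controlled by \<open>ln (1 + x) \<le> x\<close>, and the first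
    \<open>m\<close> terms by their logarithmic growth in \<tau>.\<close>
  obtain m where m: "\<bar>\<Sum>i. lam (i + m)\<bar> < q / 4"
    using suminf_exist_split[of "q / 4" lam] lam q by auto
  define L where "L = suminf lam"
  have L: "lam k \<le> L" for k
    using sum_le_suminf[OF lam(2), of "{k}"] lam(1) by (simp add: L_def)
  have L0: "0 \<le> L" using L[of 0] lam(1)[of 0] by linarith
  have "((\<lambda>\<tau>. real m * (ln (1 + 2 * (\<tau> * L)) / 2) / \<tau>) \<longlongrightarrow> 0) at_top"
  proof (cases "L = 0")
    case False
    then have "L > 0" using L0 by simp
    then show ?thesis by real_asymp
  qed simp
  then have "\<forall>\<^sub>F \<tau> in at_top. real m * (ln (1 + 2 * (\<tau> * L)) / 2) / \<tau> < q / 4"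
    using q by (intro order_tendstoD) auto
  then have "\<forall>\<^sub>F \<tau> in at_top. real m * (ln (1 + 2 * (\<tau> * L)) / 2) / \<tau> < q / 4 \<and> \<tau> > 0"
    using eventually_gt_at_top by (rule eventually_conj)
  then obtain \<tau> where \<tau>: "real m * (ln (1 + 2 * (\<tau> * L)) / 2) / \<tau> < q / 4" "0 < \<tau>"
    by (auto simp: eventually_at_top_linorder)
  define f where "f k = ln (1 + 2 * (\<tau> * lam k)) / 2" for k
  have f0: "0 \<le> f k" for k
    using \<tau> lam(1)[of k] by (simp add: f_def)
  have f1: "f k \<le> \<tau> * lam k" for k
    using \<tau> lam(1)[of k] ln_add_one_self_le_self[of "2 * (\<tau> * lam k)"] by (simp add: f_def)
  have f2: "f k \<le> ln (1 + 2 * (\<tau> * L)) / 2" for k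
    unfolding f_def using \<tau> lam(1)[of k] L[of k]
    by (intro divide_right_mono ln_mono) (auto intro!: add_pos_nonneg)
  have sf: "summable f"
    by (rule summable_comparison_test[OF _ summable_mult[OF lam(2), of \<tau>]]) (use f0 f1 in auto)
  have "suminf f = (\<Sum>i. f (i + m)) + (\<Sum>i<m. f i)"
    by (rule suminf_split_initial_segment[OF sf])
  also have "(\<Sum>i. f (i + m)) \<le> (\<Sum>i. \<tau> * lam (i + m))"
    using lam(2) sf by (intro suminf_le f1) (auto simp: summable_iff_shift intro!: summable_mult)
  also have "\<dots> = \<tau> * (\<Sum>i. lam (i + m))"
    using lam(2) by (intro suminf_mult) (simp add: summable_iff_shift)
  also have "\<dots> \<le> \<tau> * (q / 4)"
    using m \<tau>(2) by (intro mult_left_mono) auto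
  also have "(\<Sum>i<m. f i) \<le> \<tau> * (q / 4)"
    using sum_mono[of "{..<m}" f, OF f2] \<tau> by (simp add: field_simps)
  finally have total: "suminf f \<le> \<tau> * q / 2" by simp
  have "exp (- \<tau> * q / 2) \<le> (\<Prod>k<N. 1 / sqrt (1 + 2 * (\<tau> * lam k)))" for N
  proof -
    have "exp (- f k) = 1 / sqrt (1 + 2 * (\<tau> * lam k))" for k
    proof -
      have p: "0 < 1 + 2 * (\<tau> * lam k)" using \<tau> lam(1)[of k] by (auto intro: add_pos_nonneg)
      then have "f k = ln (sqrt (1 + 2 * (\<tau> * lam k)))" by (simp add: f_def ln_sqrt)
      then show ?thesis using p by (simp add: exp_minus inverse_eq_divide)
    qed
    then have "(\<Prod>k<N. 1 / sqrt (1 + 2 * (\<tau> * lam k))) = exp (- (\<Sum>k<N. f k))"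
      by (simp add: exp_sum sum_negf[symmetric])
    moreover have "(\<Sum>k<N. f k) \<le> suminf f"
      by (intro sum_le_suminf sf f0) auto
    ultimately show ?thesis using total by simp
  qed
  then show ?thesis using \<tau>(2) by blast
qed

text \<open>Take the last index whose eigenvalue is still at least \<open>eps n\<close>. The ratio
  bound \<open>D\<close> prevents the sequence from jumping far across the level
  \<open>eps n\<close> in one step.\<close>

lemma eigenvalue_at_scale:
  fixes lam eps :: "nat \<Rightarrow> real"
  assumes pos: "\<And>k. 0 < lam k" and dec: "decseq lam" and lim: "lam \<longlonglongrightarrow> 0"
    and D: "\<forall>\<^sub>F k in sequentially. lam k \<le> D * lam (Suc k)" "0 \<le> D"
    and eps: "\<And>n. 0 < n \<Longrightarrow> 0 < eps n" "eps \<longlonglongrightarrow> 0"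
  obtains \<kappa> :: "nat \<Rightarrow> nat" where "filterlim \<kappa> at_top sequentially"
    and "\<forall>\<^sub>F n in sequentially. eps n \<le> lam (\<kappa> n) \<and> lam (\<kappa> n) \<le> D * eps n"
proof -
  define \<mu> where "\<mu> n = (LEAST m. lam m < eps n)" for n
  \<comment> \<open>The subtraction is genuine for large \<open>n\<close>, because
    \<open>\<mu> n\<close> is eventually positive.\<close>
  define \<kappa> where "\<kappa> n = \<mu> n - 1" for n
  have \<mu>1: "lam (\<mu> n) < eps n" if "0 < n" for n
  proof -
    have "\<forall>\<^sub>F m in sequentially. lam m < eps n"
      using lim eps(1)[OF that] by (rule order_tendstoD)
    then show ?thesis
      unfolding \<mu>_def by (auto simp: eventually_sequentially intro: LeastI)
  qed
  have \<mu>2: "eps n \<le> lam m" if "m < \<mu> n" for n m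
    using not_less_Least that unfolding \<mu>_def by (metis not_less)
  have big: "\<forall>\<^sub>F n in sequentially. K < \<mu> n" for K
    using order_tendstoD(2)[OF eps(2) pos[of K]] eventually_gt_at_top[of 0]
  proof eventually_elim
    case (elim n)
    then show ?case using \<mu>1[of n] decseqD[OF dec, of "\<mu> n" K] by (meson less_trans not_less)
  qed
  have \<kappa>: "filterlim \<kappa> at_top sequentially"
    unfolding filterlim_at_top
  proof
    fix K show "\<forall>\<^sub>F n in sequentially. K \<le> \<kappa> n"
      using big[of K] by eventually_elim (auto simp: \<kappa>_def)
  qed
  have "\<forall>\<^sub>F n in sequentially. eps n \<le> lam (\<kappa> n) \<and> lam (\<kappa> n) \<le> D * eps n"
    using big[of 0] eventually_gt_at_top[of 0] eventually_compose_filterlim[OF D(1) \<kappa>]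
  proof eventually_elim
    case (elim n)
    then have "Suc (\<kappa> n) = \<mu> n" by (simp add: \<kappa>_def)
    then show ?case
      using elim \<mu>2[of "\<kappa> n" n] \<mu>1[of n] D(2) by (auto intro: order_trans mult_left_mono less_imp_le)
  qed
  with \<kappa> show ?thesis by (rule that)
qed

text \<open>Summability comes from the upper bound and \<open>2 * s > 1\<close>. For the ratio
  bound, the upper bound at \<open>k\<close> is compared with the lower bound at
  \<open>Suc k\<close>, using that \<open>k + 2\<close> is at most twice
  \<open>k + 1\<close>.\<close>

lemma polynomial_decay:
  fixes lam :: "nat \<Rightarrow> real"
  assumes pos: "\<And>k. 0 < lam k" and s: "s > 1 / 2"
    and lo: "Liminf sequentially (\<lambda>k. ereal (real (Suc k) powr (2 * s) * lam k)) > 0"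
    and hi: "Limsup sequentially (\<lambda>k. ereal (real (Suc k) powr (2 * s) * lam k)) < \<infinity>"
  shows "summable lam"
    and "\<exists>D\<ge>0. \<forall>\<^sub>F k in sequentially. lam k \<le> D * lam (Suc k)"
proof -
  obtain b where b: "0 < b" "ereal b < Liminf sequentially (\<lambda>k. ereal (real (Suc k) powr (2 * s) * lam k))"
    using ereal_dense2[OF lo] by auto
  have b': "\<forall>\<^sub>F k in sequentially. b < real (Suc k) powr (2 * s) * lam k"
    using less_LiminfD[OF b(2)] by simp
  obtain B where B: "Limsup sequentially (\<lambda>k. ereal (real (Suc k) powr (2 * s) * lam k)) < ereal B"
    using ereal_dense2[OF hi] by auto
  have B': "\<forall>\<^sub>F k in sequentially. real (Suc k) powr (2 * s) * lam k < B"
    using Limsup_lessD[OF B] by simp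
  have up: "\<forall>\<^sub>F k in sequentially. lam k \<le> B * real (Suc k) powr (- (2 * s))"
    using B' by eventually_elim (simp add: powr_minus field_simps)
  have "summable (\<lambda>k. real k powr (- (2 * s)))"
    using s by (simp add: summable_real_powr_iff)
  then have "summable (\<lambda>k. B * real (Suc k) powr (- (2 * s)))"
    by (intro summable_mult) (subst summable_Suc_iff)
  moreover have "\<forall>\<^sub>F k in sequentially. norm (lam k) \<le> B * real (Suc k) powr (- (2 * s))"
    using up by eventually_elim (simp add: pos less_imp_le)
  ultimately show "summable lam"
    by (rule summable_comparison_test_ev[rotated])
  \<comment> \<open>The sign of the constant is carried inside the eventual statement, since
    \<open>B > 0\<close> is read off from an index where the upper bound holds.\<close>
  have "\<forall>\<^sub>F k in sequentially. lam k \<le> (B / b * 2 powr (2 * s)) * lam (Suc k) \<and> 0 \<le> B / b * 2 powr (2 * s)"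
    using up B' b'[THEN eventually_compose_filterlim, OF filterlim_Suc]
  proof eventually_elim
    case (elim k)
    have Bp: "0 < B"
      using elim(2) pos[of k] by (meson less_trans mult_pos_pos of_nat_0_less_iff powr_gt_zero zero_less_Suc less_numeral_extra(3) of_nat_neq_0)
    have "real (Suc (Suc k)) powr (2 * s) \<le> (2 * real (Suc k)) powr (2 * s)"
      using s by (intro powr_mono2) auto
    also have "\<dots> = 2 powr (2 * s) * real (Suc k) powr (2 * s)"
      by (rule powr_mult)
    finally have "real (Suc (Suc k)) powr (2 * s) * lam (Suc k) \<le> 2 powr (2 * s) * real (Suc k) powr (2 * s) * lam (Suc k)"
      using pos[of "Suc k"] by (intro mult_right_mono) auto
    then have "b \<le> 2 powr (2 * s) * real (Suc k) powr (2 * s) * lam (Suc k)"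
      using elim(3) by linarith
    then have "B / b * b * real (Suc k) powr (- (2 * s))
        \<le> B / b * (2 powr (2 * s) * real (Suc k) powr (2 * s) * lam (Suc k)) * real (Suc k) powr (- (2 * s))"
      using Bp b(1) by (intro mult_right_mono mult_left_mono) auto
    also have "\<dots> = (B / b * 2 powr (2 * s)) * lam (Suc k)"
      by (simp add: powr_minus)
    finally show ?case using elim(1) Bp b(1) by simp
  qed
  then show "\<exists>D\<ge>0. \<forall>\<^sub>F k in sequentially. lam k \<le> D * lam (Suc k)"
    by (intro exI[of _ "B / b * 2 powr (2 * s)"]) (auto simp: eventually_conj_iff)
qed

section \<open>Consistency\<close>

text \<open>Polynomial decay is represented here by summability of \<open>lam\<close>. The uniform
  bound \<open>C\<close> is taken positive so that \<open>1 / C\<close> can later limit the size of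
  a perturbation.\<close>

locale bounded_eigensystem = P0: prob_space P0 for P0 :: "'a measure" +
  fixes lam :: "nat \<Rightarrow> real" and phi :: "nat \<Rightarrow> 'a \<Rightarrow> real" and C :: real
  assumes phi_meas[measurable]: "\<And>k. phi k \<in> borel_measurable P0"
    and phi_orth: "\<And>j k. (\<integral>x. phi j x * phi k x \<partial>P0) = (if j = k then 1 else 0)"
    and phi_mean: "\<And>k. (\<integral>x. phi k x \<partial>P0) = 0"
    and C_pos: "0 < C" and phi_bdd: "\<And>k x. x \<in> space P0 \<Longrightarrow> \<bar>phi k x\<bar> \<le> C"
    and lam_pos: "\<And>k. 0 < lam k" and lam_summable: "summable lam"
begin

lemma lam_nonneg: "0 \<le> lam k"
  using lam_pos[of k] by simp

lemma lam_div_summable: "summable (\<lambda>k. lam k / c)"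
  using lam_summable by (rule summable_divide)

context
  fixes P :: "'a measure"
  assumes P: "prob_space P" and sets_P: "sets P = sets P0"
begin

lemma phi_meas': "phi k \<in> borel_measurable P"
  using phi_meas[of k] by (simp add: measurable_cong_sets[OF sets_P refl])

lemma phi_bdd': "x \<in> space P \<Longrightarrow> \<bar>phi k x\<bar> \<le> C"
  using phi_bdd sets_eq_imp_space_eq[OF sets_P] by simp

lemma phi_integrable: "integrable P (phi k)"
  using P by (intro finite_measure.integrable_const_bound[where B = C])
    (auto simp: phi_bdd' phi_meas' prob_space_def)

lemma phi_sum_square_summable:
  "x \<in> space (PiM {..<n} (\<lambda>_. P)) \<Longrightarrow> summable (\<lambda>k. lam k / real n * (\<Sum>i<n. phi k (x i))\<^sup>2)"
  by (rule weighted_sum_square_PiM(1)[OF P phi_meas' phi_bdd' _ lam_div_summable])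
     (auto simp: lam_nonneg)

text \<open>Puts the statistic into the weighted form of \<open>weighted_sum_square_PiM\<close>,
  with weights \<open>lam k / real n\<close>.\<close>

lemma mmd_sq_eq:
  assumes "x \<in> space (PiM {..<n} (\<lambda>_. P))" "0 < n"
  shows "real n * mmd_sq lam phi n x = (\<Sum>k. lam k / real n * (\<Sum>i<n. phi k (x i))\<^sup>2)"
proof -
  have e: "lam k / real n * (\<Sum>i<n. phi k (x i))\<^sup>2 = real n * (lam k * ((1 / real n) * (\<Sum>i<n. phi k (x i)))\<^sup>2)" for k
    using assms(2) by (simp add: power_mult_distrib power_divide field_simps power2_eq_square)
  have "summable (\<lambda>k. real n * (lam k * ((1 / real n) * (\<Sum>i<n. phi k (x i)))\<^sup>2))"
    using phi_sum_square_summable[OF assms(1)] unfolding e .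
  then have "summable (\<lambda>k. lam k * ((1 / real n) * (\<Sum>i<n. phi k (x i)))\<^sup>2)"
    using assms(2) by (subst (asm) summable_cmult_iff) auto
  then show ?thesis
    unfolding e mmd_sq_def by (rule suminf_mult[symmetric])
qed

lemma T_MMD_measurable: "T_MMD lam phi \<alpha> n \<in> borel_measurable (PiM {..<n} (\<lambda>_. P))"
proof -
  note [measurable] = phi_meas'
  show ?thesis unfolding T_MMD_def[abs_def] mmd_sq_def by measurable
qed

lemma accept_integrable: "integrable (PiM {..<n} (\<lambda>_. P)) (\<lambda>x. 1 - T_MMD lam phi \<alpha> n x)"
proof -
  interpret Q: prob_space "PiM {..<n} (\<lambda>_. P)" by (intro prob_space_PiM P)
  note [measurable] = T_MMD_measurable
  show ?thesis
    by (rule Q.integrable_const_bound[where B = 1], simp add: T_MMD_def, measurable)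
qed

lemma accept_prob_bounds:
  "0 \<le> (\<integral>x. 1 - T_MMD lam phi \<alpha> n x \<partial>PiM {..<n} (\<lambda>_. P))"
  "(\<integral>x. 1 - T_MMD lam phi \<alpha> n x \<partial>PiM {..<n} (\<lambda>_. P)) \<le> 1"
proof -
  interpret Q: prob_space "PiM {..<n} (\<lambda>_. P)" by (intro prob_space_PiM P)
  show "0 \<le> (\<integral>x. 1 - T_MMD lam phi \<alpha> n x \<partial>PiM {..<n} (\<lambda>_. P))"
    by (rule integral_nonneg_AE) (auto simp: T_MMD_def)
  have "(\<integral>x. 1 - T_MMD lam phi \<alpha> n x \<partial>PiM {..<n} (\<lambda>_. P)) \<le> (\<integral>x. 1 \<partial>PiM {..<n} (\<lambda>_. P))"
    by (intro integral_mono accept_integrable) (auto simp: T_MMD_def)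
  then show "(\<integral>x. 1 - T_MMD lam phi \<alpha> n x \<partial>PiM {..<n} (\<lambda>_. P)) \<le> 1"
    by (simp add: Q.prob_space)
qed

end

section \<open>From acceptance probabilities to the type II error\<close>

text \<open>The real \<open>Sup\<close> is an upper bound only for sets that are bounded above; here
  every element is at most 1.\<close>

lemma bdd_above_accept:
  "bdd_above (insert 0 ((\<lambda>P. \<integral>x. 1 - T_MMD lam phi \<alpha> n x \<partial>(PiM {..<n} (\<lambda>_. P))) ` Palt P0 lam phi \<Delta> M))"
  by (rule bdd_aboveI[where M = 1]) (auto simp: Palt_def intro: accept_prob_bounds(2))

lemma typeII_nonneg: "0 \<le> typeII P0 lam phi \<alpha> \<Delta> M n"
  unfolding typeII_def by (rule cSup_upper[OF _ bdd_above_accept]) simp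

lemma typeII_le:
  assumes "0 \<le> c" "\<And>P. P \<in> Palt P0 lam phi \<Delta> M \<Longrightarrow>
    (\<integral>x. 1 - T_MMD lam phi \<alpha> n x \<partial>PiM {..<n} (\<lambda>_. P)) \<le> c"
  shows "typeII P0 lam phi \<alpha> \<Delta> M n \<le> c"
  unfolding typeII_def by (rule cSup_least) (use assms in auto)

lemma typeII_ge:
  assumes "P \<in> Palt P0 lam phi \<Delta> M"
  shows "(\<integral>x. 1 - T_MMD lam phi \<alpha> n x \<partial>PiM {..<n} (\<lambda>_. P)) \<le> typeII P0 lam phi \<alpha> \<Delta> M n"
  unfolding typeII_def by (rule cSup_upper[OF _ bdd_above_accept]) (use assms in auto)

text \<open>Change of measure by the Radon-Nikodym derivative; the \<open>- 1\<close> in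
  \<open>udens\<close> contributes nothing because the eigenfunctions have mean zero under
  \<open>P0\<close>.\<close>

lemma coef_udens:
  assumes "P \<in> Palt P0 lam phi \<Delta> M"
  shows "coef P0 phi (udens P0 P) k = (\<integral>x. phi k x \<partial>P)"
proof -
  have P: "prob_space P" "sets P = sets P0" "absolutely_continuous P0 P"
    using assms by (auto simp: Palt_def)
  interpret P: prob_space P by (rule P)
  have sf: "sigma_finite_measure P" ..
  have "integrable P0 (\<lambda>x. enn2real (RN_deriv P0 P x) * phi k x)"
    using P0.RN_deriv_integrable[OF sf P(3,2) phi_meas, of k] phi_integrable[OF P(1,2)] by simp
  moreover have "(\<integral>x. phi k x \<partial>P) = (\<integral>x. enn2real (RN_deriv P0 P x) * phi k x \<partial>P0)"
    by (rule P0.RN_deriv_integral[OF sf P(3,2) phi_meas])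
  ultimately show ?thesis
    using phi_integrable[OF P0.prob_space_axioms refl]
    by (simp add: coef_def udens_def left_diff_distrib phi_mean)
qed

text \<open>By the inequality of arithmetic and geometric means, each term is dominated by the sum
  of \<open>(coef P0 phi u k)^2 / lam k\<close> and \<open>lam k\<close>. Together with the bound on
  \<open>phi\<close> this makes the eigenfunction expansion converge uniformly.\<close>

lemma RKHS_coef_abs_summable:
  assumes "in_RKHS P0 lam phi u"
  shows "summable (\<lambda>k. \<bar>coef P0 phi u k\<bar>)"
proof (rule summable_comparison_test)
  let ?a = "coef P0 phi u"
  show "summable (\<lambda>k. (?a k)\<^sup>2 / lam k + lam k)"
    using assms lam_summable by (intro summable_add) (auto simp: in_RKHS_def)
  have "\<bar>?a k\<bar> \<le> (?a k)\<^sup>2 / lam k + lam k" for k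
  proof -
    have "2 * lam k * \<bar>?a k\<bar> \<le> (lam k)\<^sup>2 + (?a k)\<^sup>2"
      using sum_squares_bound[of "lam k" "\<bar>?a k\<bar>"] by simp
    moreover have "0 \<le> lam k * \<bar>?a k\<bar>" using lam_nonneg by simp
    ultimately have "lam k * \<bar>?a k\<bar> \<le> (lam k)\<^sup>2 + (?a k)\<^sup>2" by linarith
    then show ?thesis
      using lam_pos[of k] by (simp add: field_simps power2_eq_square)
  qed
  then show "\<exists>N. \<forall>k\<ge>N. norm \<bar>?a k\<bar> \<le> (?a k)\<^sup>2 / lam k + lam k" by auto
qed

end

section \<open>Parseval's identity and the size of the signal\<close>

locale complete_eigensystem = bounded_eigensystem +
  assumes phi_complete: "\<And>f. L2 P0 f \<Longrightarrow> (\<integral>x. f x \<partial>P0) = 0 \<Longrightarrow>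
      (\<forall>k. (\<integral>x. f x * phi k x \<partial>P0) = 0) \<Longrightarrow> AE x in P0. f x = 0"
begin

text \<open>The eigenfunction expansion of an RKHS element converges uniformly, so completeness yields
  Parseval's identity without recourse to the Riesz--Fischer theorem.\<close>
lemma RKHS_parseval:
  assumes u: "in_RKHS P0 lam phi u"
  shows "summable (\<lambda>k. (coef P0 phi u k)\<^sup>2)"
    and "(\<integral>x. (u x)\<^sup>2 \<partial>P0) = (\<Sum>k. (coef P0 phi u k)\<^sup>2)"
proof -
  define a where "a = coef P0 phi u"
  have um[measurable]: "u \<in> borel_measurable P0" and u2: "integrable P0 (\<lambda>x. (u x)\<^sup>2)"
    and um0: "(\<integral>x. u x \<partial>P0) = 0"
    using u by (auto simp: in_RKHS_def L2_def)
  have ui: "integrable P0 u"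
    using um u2 by (rule P0.square_integrable_imp_integrable)
  have sa: "summable (\<lambda>k. \<bar>a k\<bar>)"
    unfolding a_def by (rule RKHS_coef_abs_summable[OF u])
  have sac: "summable (\<lambda>k. \<bar>a k\<bar> * c)" for c
    using sa by (rule summable_mult2)
  define v where "v x = (\<Sum>k. a k * phi k x)" for x
  have vm[measurable]: "v \<in> borel_measurable P0"
    unfolding v_def[abs_def] by measurable
  have nb: "norm (a k * phi k x) \<le> \<bar>a k\<bar> * C" if "x \<in> space P0" for k x
    using phi_bdd[OF that, of k] by (auto simp: abs_mult intro: mult_left_mono)
  have sv: "summable (\<lambda>k. norm (a k * phi k x))" if "x \<in> space P0" for x
    by (rule summable_comparison_test[OF _ sac[of C]]) (use nb[OF that] in auto)
  \<comment> \<open>As \<open>v\<close> is a uniformly convergent series of bounded functions, it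
    can be integrated termwise against any integrable \<open>f\<close>. The choices
    \<open>1\<close>, \<open>v\<close>, \<open>u\<close> and \<open>phi j\<close> for
    \<open>f\<close> give all the facts about \<open>v\<close> that are needed.\<close>
  have termwise: "integrable P0 (\<lambda>x. f x * v x) \<and> (\<lambda>k. a k * (\<integral>x. f x * phi k x \<partial>P0)) sums (\<integral>x. f x * v x \<partial>P0)"
    if f: "integrable P0 f" for f
  proof -
    have fb: "norm (f x * (a k * phi k x)) \<le> \<bar>a k\<bar> * C * \<bar>f x\<bar>" if "x \<in> space P0" for k x
      using mult_left_mono[OF nb[OF that, of k], of "\<bar>f x\<bar>"]
      by (simp only: abs_mult real_norm_def mult_ac abs_ge_zero)
    have fi: "integrable P0 (\<lambda>x. f x * (a k * phi k x))" for k
    proof (rule Bochner_Integration.integrable_bound[OF integrable_mult_right[OF f, of "\<bar>a k\<bar> * C"]])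
      show "AE x in P0. norm (f x * (a k * phi k x)) \<le> norm (\<bar>a k\<bar> * C * f x)"
        using fb[of _ k] C_pos by (intro AE_I2) (simp add: abs_mult)
    qed (use f in measurable)
    have s1: "AE x in P0. summable (\<lambda>k. norm (f x * (a k * phi k x)))"
    proof (rule AE_I2)
      fix x assume "x \<in> space P0"
      then show "summable (\<lambda>k. norm (f x * (a k * phi k x)))"
        using summable_mult[OF sv, of x "\<bar>f x\<bar>"] by (simp only: abs_mult real_norm_def)
    qed
    have s2: "summable (\<lambda>k. \<integral>x. norm (f x * (a k * phi k x)) \<partial>P0)"
    proof (rule summable_comparison_test[OF _ sac[of "C * (\<integral>x. \<bar>f x\<bar> \<partial>P0)"]], intro exI allI impI)
      fix k
      have "(\<integral>x. norm (f x * (a k * phi k x)) \<partial>P0) \<le> (\<integral>x. \<bar>a k\<bar> * C * \<bar>f x\<bar> \<partial>P0)"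
        using fi[of k] f fb[of _ k] by (intro integral_mono) auto
      then show "norm (\<integral>x. norm (f x * (a k * phi k x)) \<partial>P0) \<le> \<bar>a k\<bar> * (C * (\<integral>x. \<bar>f x\<bar> \<partial>P0))"
        by (simp add: mult_ac)
    qed
    have e: "(\<Sum>k. f x * (a k * phi k x)) = f x * v x" if "x \<in> space P0" for x
      unfolding v_def by (rule suminf_mult[OF summable_norm_cancel[OF sv[OF that]]])
    have "integrable P0 (\<lambda>x. \<Sum>k. f x * (a k * phi k x))"
      by (rule integrable_suminf[OF fi s1 s2])
    moreover have "(\<lambda>k. \<integral>x. f x * (a k * phi k x) \<partial>P0) sums (\<integral>x. (\<Sum>k. f x * (a k * phi k x)) \<partial>P0)"
      by (rule sums_integral[OF fi s1 s2])
    moreover have "(\<integral>x. f x * (a k * phi k x) \<partial>P0) = a k * (\<integral>x. f x * phi k x \<partial>P0)" for k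
      by (simp add: mult.left_commute)
    moreover have "(\<integral>x. (\<Sum>k. f x * (a k * phi k x)) \<partial>P0) = (\<integral>x. f x * v x \<partial>P0)"
      by (intro Bochner_Integration.integral_cong refl e)
    moreover have "integrable P0 (\<lambda>x. \<Sum>k. f x * (a k * phi k x)) = integrable P0 (\<lambda>x. f x * v x)"
      by (intro Bochner_Integration.integrable_cong refl e)
    ultimately show ?thesis by simp
  qed
  have vi: "integrable P0 v" and v0: "(\<integral>x. v x \<partial>P0) = 0"
    using termwise[of "\<lambda>_. 1"] by (auto simp: phi_mean sums_iff)
  have v2: "integrable P0 (\<lambda>x. v x * v x)"
    using termwise[OF vi] by simp
  have uv: "integrable P0 (\<lambda>x. u x * v x)" "(\<lambda>k. a k * a k) sums (\<integral>x. u x * v x \<partial>P0)"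
    using termwise[OF ui] by (auto simp: a_def coef_def)
  have vphi: "(\<integral>x. v x * phi j x \<partial>P0) = a j" for j
  proof -
    have "(\<lambda>k. a k * (if j = k then 1 else 0)) sums (\<integral>x. phi j x * v x \<partial>P0)"
      using termwise[OF phi_integrable[OF P0.prob_space_axioms refl], of j] by (simp add: phi_orth)
    moreover have "(\<lambda>k. a k * (if j = k then 1 else 0)) sums a j"
      using sums_If_finite_set[of "{j}" a] by (simp add: if_distrib[of "\<lambda>x. _ * x"] eq_commute[of j] cong: if_cong)
    ultimately show ?thesis
      by (simp add: sums_unique2[of _ "\<integral>x. phi j x * v x \<partial>P0" "a j"] mult.commute[of "v _"])
  qed
  have bi: "integrable P0 (\<lambda>x. f x * phi k x)" if "integrable P0 f" for f k
  proof (rule Bochner_Integration.integrable_bound[OF integrable_mult_right[OF that, of C]])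
    show "AE x in P0. norm (f x * phi k x) \<le> norm (C * f x)"
      using phi_bdd[of _ k] C_pos by (intro AE_I2) (auto simp: abs_mult mult.commute[of _ "\<bar>f _\<bar>"] intro!: mult_left_mono)
  qed (use that in measurable)
  \<comment> \<open>Both functions have mean zero and the same coefficients, so completeness
    identifies them.\<close>
  have "AE x in P0. u x - v x = 0"
  proof (rule phi_complete)
    show "L2 P0 (\<lambda>x. u x - v x)"
    proof -
      have "(u x - v x)\<^sup>2 = (u x)\<^sup>2 - 2 * (u x * v x) + v x * v x" for x
        by (simp add: power2_eq_square algebra_simps)
      then show ?thesis
        using u2 v2 uv(1) by (simp add: L2_def)
    qed
    show "(\<integral>x. u x - v x \<partial>P0) = 0"
      using ui vi um0 v0 by simp
    show "\<forall>k. (\<integral>x. (u x - v x) * phi k x \<partial>P0) = 0"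
      using bi[OF ui] bi[OF vi] vphi by (simp add: left_diff_distrib) (simp add: a_def coef_def)
  qed
  then have "(\<integral>x. (u x)\<^sup>2 \<partial>P0) = (\<integral>x. u x * v x \<partial>P0)"
    by (intro integral_cong_AE) (auto simp: power2_eq_square)
  then show "summable (\<lambda>k. (coef P0 phi u k)\<^sup>2)"
    and "(\<integral>x. (u x)\<^sup>2 \<partial>P0) = (\<Sum>k. (coef P0 phi u k)\<^sup>2)"
    using uv(2) by (auto simp: a_def power2_eq_square sums_iff)
qed

text \<open>The Cauchy-Schwarz bound of the squared sum of \<open>a k^2\<close> by the sums of
  \<open>lam k * a k^2\<close> and \<open>a k^2 / lam k\<close>, carried out through a weighted
  arithmetic-geometric mean inequality so that only termwise comparison of series is used.\<close>

lemma RKHS_weighted_norm_ge: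
  assumes u: "u \<in> F0 P0 lam phi M" and M: "0 < M" and \<Delta>: "0 < \<Delta>" "\<Delta> \<le> (\<integral>x. (u x)\<^sup>2 \<partial>P0)"
  shows "summable (\<lambda>k. lam k * (coef P0 phi u k)\<^sup>2)"
    and "\<Delta>\<^sup>2 / M\<^sup>2 \<le> (\<Sum>k. lam k * (coef P0 phi u k)\<^sup>2)"
proof -
  define a where "a = coef P0 phi u"
  have uR: "in_RKHS P0 lam phi u" and nM: "sqrt (\<Sum>k. (a k)\<^sup>2 / lam k) \<le> M"
    using u by (auto simp: F0_def RKHS_norm_def a_def)
  have s1: "summable (\<lambda>k. (a k)\<^sup>2 / lam k)"
    using uR by (simp add: in_RKHS_def a_def)
  have nM2: "(\<Sum>k. (a k)\<^sup>2 / lam k) \<le> M\<^sup>2"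
    using nM by (rule sqrt_le_D)
  note pars = RKHS_parseval[OF uR, folded a_def]
  have "lam k \<le> suminf lam" for k
    using sum_le_suminf[OF lam_summable, of "{k}"] lam_nonneg by simp
  then have sl: "summable (\<lambda>k. lam k * (a k)\<^sup>2)"
    using lam_nonneg by (intro summable_comparison_test[OF _ summable_mult[OF pars(1), of "suminf lam"]])
      (auto simp: abs_mult intro!: mult_right_mono)
  then show "summable (\<lambda>k. lam k * (coef P0 phi u k)\<^sup>2)" by (simp add: a_def)
  \<comment> \<open>With this weight the RKHS term costs at most \<open>M^2 / t = \<Delta>\<close>,
    half of the available \<open>2 * \<Delta>\<close>.\<close>
  define t where "t = M\<^sup>2 / \<Delta>"
  have t: "0 < t" using M \<Delta> by (simp add: t_def)
  have amgm: "2 * (a k)\<^sup>2 \<le> t * (lam k * (a k)\<^sup>2) + (1 / t) * ((a k)\<^sup>2 / lam k)" for k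
  proof -
    have p: "0 < t * lam k" using t lam_pos by simp
    have "2 \<le> y + 1 / y" if "0 < y" for y :: real
      using that sum_squares_bound[of y 1] by (simp add: field_simps power2_eq_square)
    from this[OF p] have "2 * (a k)\<^sup>2 \<le> (t * lam k + 1 / (t * lam k)) * (a k)\<^sup>2"
      by (rule mult_right_mono) simp
    also have "\<dots> = t * (lam k * (a k)\<^sup>2) + (1 / t) * ((a k)\<^sup>2 / lam k)"
      by (simp add: distrib_right)
    finally show ?thesis .
  qed
  have "2 * \<Delta> \<le> 2 * (\<Sum>k. (a k)\<^sup>2)"
    using \<Delta> pars(2) by simp
  also have "\<dots> = (\<Sum>k. 2 * (a k)\<^sup>2)"
    by (rule suminf_mult[OF pars(1), symmetric])
  also have "\<dots> \<le> (\<Sum>k. t * (lam k * (a k)\<^sup>2) + (1 / t) * ((a k)\<^sup>2 / lam k))"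
    using pars(1) sl s1 by (intro suminf_le amgm summable_add summable_mult)
  also have "\<dots> = t * (\<Sum>k. lam k * (a k)\<^sup>2) + (1 / t) * (\<Sum>k. (a k)\<^sup>2 / lam k)"
    by (subst suminf_add[OF summable_mult[OF sl] summable_mult[OF s1], symmetric])
       (simp only: suminf_mult[OF sl] suminf_mult[OF s1])
  also have "\<dots> \<le> t * (\<Sum>k. lam k * (a k)\<^sup>2) + (1 / t) * M\<^sup>2"
    using nM2 t by (intro add_left_mono mult_left_mono) auto
  also have "(1 / t) * M\<^sup>2 = \<Delta>"
    using M \<Delta> by (simp add: t_def)
  finally have "\<Delta> \<le> M\<^sup>2 / \<Delta> * (\<Sum>k. lam k * (a k)\<^sup>2)"
    by (simp add: t_def)
  then show "\<Delta>\<^sup>2 / M\<^sup>2 \<le> (\<Sum>k. lam k * (coef P0 phi u k)\<^sup>2)"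
    using M \<Delta> by (simp add: a_def[symmetric] field_simps power2_eq_square)
qed

section \<open>Acceptance under a separated alternative\<close>

text \<open>The statistic and the centred fluctuation \<open>G\<close> together control the signal,
  so acceptance forces \<open>G x \<ge> A\<close>. Centring at most doubles the bound on the
  eigenfunctions, which is the source of the factor 4 in the bound on the mean of
  \<open>G\<close>.\<close>

lemma accept_prob_le:
  assumes Palt: "P \<in> Palt P0 lam phi \<Delta> M" and M: "0 < M" and \<Delta>: "0 < \<Delta>" and n: "0 < n"
    and A: "0 < A" "2 * q_w lam \<alpha> + 2 * A \<le> real n * (\<Delta>\<^sup>2 / M\<^sup>2)"
  shows "(\<integral>x. 1 - T_MMD lam phi \<alpha> n x \<partial>PiM {..<n} (\<lambda>_. P)) \<le> 4 * C\<^sup>2 * suminf lam / A"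
proof -
  have P: "prob_space P" "sets P = sets P0"
    and u: "udens P0 P \<in> F0 P0 lam phi M" "\<Delta> \<le> (\<integral>x. (udens P0 P x)\<^sup>2 \<partial>P0)"
    using Palt by (auto simp: Palt_def chi2_def)
  interpret P: prob_space P by (rule P)
  let ?Q = "PiM {..<n} (\<lambda>_. P)"
  define a where "a k = (\<integral>x. phi k x \<partial>P)" for k
  have ca: "coef P0 phi (udens P0 P) = a"
    using coef_udens[OF Palt] by (auto simp: a_def)
  note sig = RKHS_weighted_norm_ge[OF u(1) M \<Delta> u(2), unfolded ca]
  define g where "g k x = phi k x - a k" for k x
  note [measurable] = phi_meas'[OF P]
  have gm[measurable]: "g k \<in> borel_measurable P" for k
    unfolding g_def by measurable
  have ab: "\<bar>a k\<bar> \<le> C" for k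
  proof -
    have "(\<integral>x. \<bar>phi k x\<bar> \<partial>P) \<le> (\<integral>x. C \<partial>P)"
      using phi_integrable[OF P] by (intro integral_mono) (auto simp: phi_bdd'[OF P])
    then show ?thesis
      unfolding a_def by (intro order_trans[OF integral_abs_bound]) (simp add: P.prob_space)
  qed
  have gb: "\<bar>g k x\<bar> \<le> 2 * C" if "x \<in> space P" for k x
    using ab[of k] phi_bdd'[OF P that, of k] unfolding g_def by linarith
  have g0: "(\<integral>x. g k x \<partial>P) = 0" for k
    unfolding g_def using phi_integrable[OF P] by (simp add: P.prob_space a_def)
  define G where "G x = (\<Sum>k. lam k / real n * (\<Sum>i<n. g k (x i))\<^sup>2)" for x
  have w: "0 \<le> lam k / real n" for k using lam_nonneg by simp
  have G1: "summable (\<lambda>k. lam k / real n * (\<Sum>i<n. g k (x i))\<^sup>2)" if "x \<in> space ?Q" for x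
    by (rule weighted_sum_square_PiM(1)[OF P(1) gm gb w lam_div_summable that])
  have G2: "integrable ?Q G"
    unfolding G_def[abs_def] by (rule weighted_sum_square_PiM(2)[OF P(1) gm gb w lam_div_summable])
  have "(\<integral>x. G x \<partial>?Q) \<le> (\<Sum>k. lam k / real n * (real n * (2 * C)\<^sup>2 + (real n * (\<integral>x. g k x \<partial>P))\<^sup>2))"
    unfolding G_def by (rule weighted_sum_square_PiM(3)[OF P(1) gm gb w lam_div_summable])
  also have "\<dots> = (\<Sum>k. lam k * (4 * C\<^sup>2))"
    using n by (simp add: g0 power_mult_distrib)
  also have "\<dots> = 4 * C\<^sup>2 * suminf lam"
    by (subst suminf_mult2[OF lam_summable, symmetric]) (simp add: mult.commute)
  finally have EG: "(\<integral>x. G x \<partial>?Q) \<le> 4 * C\<^sup>2 * suminf lam" .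
  \<comment> \<open>Markov's inequality in pointwise form: the acceptance indicator lies below
    \<open>G x / A\<close>.\<close>
  have "1 - T_MMD lam phi \<alpha> n x \<le> G x / A" if x: "x \<in> space ?Q" for x
  proof (cases "real n * mmd_sq lam phi n x > q_w lam \<alpha>")
    case True
    have "0 \<le> G x"
      unfolding G_def using lam_nonneg by (intro suminf_nonneg G1[OF x]) auto
    then show ?thesis using True A by (simp add: T_MMD_def)
  next
    case False
    let ?S = "\<lambda>k. lam k / real n * (\<Sum>i<n. phi k (x i))\<^sup>2"
    let ?G = "\<lambda>k. lam k / real n * (\<Sum>i<n. g k (x i))\<^sup>2"
    have pw: "real n * (lam k * (a k)\<^sup>2) \<le> 2 * (?S k + ?G k)" for k
    proof -
      have "real n * a k = (\<Sum>i<n. phi k (x i)) - (\<Sum>i<n. g k (x i))"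
        by (simp add: g_def sum_subtractf)
      then have "(real n * a k)\<^sup>2 \<le> 2 * ((\<Sum>i<n. phi k (x i))\<^sup>2 + (\<Sum>i<n. g k (x i))\<^sup>2)"
        using sum_squares_bound[of "\<Sum>i<n. phi k (x i)" "- (\<Sum>i<n. g k (x i))"] by (simp add: power2_diff)
      then have "lam k / real n * (real n * a k)\<^sup>2 \<le> lam k / real n * (2 * ((\<Sum>i<n. phi k (x i))\<^sup>2 + (\<Sum>i<n. g k (x i))\<^sup>2))"
        by (rule mult_left_mono[OF _ w])
      also have "\<dots> = 2 * (?S k + ?G k)" by (simp add: algebra_simps add_divide_distrib)
      also have "lam k / real n * (real n * a k)\<^sup>2 = real n * (lam k * (a k)\<^sup>2)"
        using n by (simp add: power2_eq_square)
      finally show ?thesis .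
    qed
    have sS: "summable ?S" by (rule phi_sum_square_summable[OF P x])
    have sG: "summable ?G" by (rule G1[OF x])
    have "2 * q_w lam \<alpha> + 2 * A \<le> real n * (\<Sum>k. lam k * (a k)\<^sup>2)"
      using A(2) mult_left_mono[OF sig(2), of "real n"] by linarith
    also have "\<dots> = (\<Sum>k. real n * (lam k * (a k)\<^sup>2))"
      by (rule suminf_mult[OF sig(1), symmetric])
    also have "\<dots> \<le> (\<Sum>k. 2 * (?S k + ?G k))"
      using sig(1) sS sG by (intro suminf_le pw summable_mult summable_add)
    also have "\<dots> = 2 * (real n * mmd_sq lam phi n x + G x)"
      by (simp only: suminf_mult[OF summable_add[OF sS sG]] suminf_add[OF sS sG, symmetric] mmd_sq_eq[OF P x n] G_def)
    finally have "A \<le> G x"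
      using False unfolding distrib_left[of 2] by (simp only: not_less)
    then show ?thesis using False A by (simp add: T_MMD_def)
  qed
  then have "(\<integral>x. 1 - T_MMD lam phi \<alpha> n x \<partial>?Q) \<le> (\<integral>x. G x / A \<partial>?Q)"
    using G2 by (intro integral_mono accept_integrable[OF P]) auto
  also have "\<dots> \<le> 4 * C\<^sup>2 * suminf lam / A"
    using EG A(1) by (simp add: divide_right_mono)
  finally show ?thesis .
qed

lemma typeII_tendsto_0:
  assumes M: "0 < M" and \<Delta>: "\<And>n. 0 < \<Delta> n"
    and lim: "filterlim (\<lambda>n. sqrt (real n) * \<Delta> n) at_top sequentially"
  shows "(\<lambda>n. typeII P0 lam phi \<alpha> (\<Delta> n) M n) \<longlonglongrightarrow> 0"
proof -
  \<comment> \<open>Chosen so that the separation condition of \<open>accept_prob_le\<close> holds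
    with equality.\<close>
  define A where "A n = (sqrt (real n) * \<Delta> n)\<^sup>2 / (2 * M\<^sup>2) - q_w lam \<alpha>" for n
  define K where "K = 4 * C\<^sup>2 * suminf lam"
  have K: "0 \<le> K"
    unfolding K_def using lam_nonneg lam_summable by (simp add: suminf_nonneg)
  have "filterlim (\<lambda>n. (sqrt (real n) * \<Delta> n) * (sqrt (real n) * \<Delta> n)) at_top sequentially"
    by (rule filterlim_at_top_mult_at_top[OF lim lim])
  then have "filterlim (\<lambda>n. 1 / (2 * M\<^sup>2) * (sqrt (real n) * \<Delta> n)\<^sup>2) at_top sequentially"
    using M by (intro filterlim_tendsto_pos_mult_at_top[OF tendsto_const]) (auto simp: power2_eq_square)
  then have "filterlim (\<lambda>n. - q_w lam \<alpha> + 1 / (2 * M\<^sup>2) * (sqrt (real n) * \<Delta> n)\<^sup>2) at_top sequentially"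
    by (rule filterlim_tendsto_add_at_top[OF tendsto_const])
  then have At: "filterlim A at_top sequentially"
    by (simp add: A_def[abs_def])
  have lim0: "(\<lambda>n. K / A n) \<longlonglongrightarrow> 0"
    by (rule real_tendsto_divide_at_top[OF tendsto_const At])
  have "\<forall>\<^sub>F n in sequentially. typeII P0 lam phi \<alpha> (\<Delta> n) M n \<le> K / A n"
    using filterlim_at_top_dense[THEN iffD1, OF At, rule_format, of 0] eventually_gt_at_top[of 0]
  proof eventually_elim
    case (elim n)
    have "2 * q_w lam \<alpha> + 2 * A n \<le> real n * ((\<Delta> n)\<^sup>2 / M\<^sup>2)"
      by (simp add: A_def power_mult_distrib)
    then have "(\<integral>x. 1 - T_MMD lam phi \<alpha> n x \<partial>PiM {..<n} (\<lambda>_. P)) \<le> K / A n"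
      if "P \<in> Palt P0 lam phi (\<Delta> n) M" for P
      unfolding K_def using accept_prob_le[OF that M \<Delta>] elim by blast
    then show ?case
      using elim K by (intro typeII_le) simp_all
  qed
  from tendsto_sandwich[OF _ this tendsto_const lim0] show ?thesis
    by (simp add: typeII_nonneg)
qed

end

section \<open>The lower bound\<close>

context bounded_eigensystem
begin

section \<open>Perturbations of \<open>P0\<close> along one eigenfunction\<close>

text \<open>The cast to \<open>ennreal\<close> cuts negative values off at 0; the condition
  \<open>\<bar>a\<bar> * C \<le> 1\<close> imposed below keeps the density nonnegative, so that
  nothing is cut.\<close>

definition alt :: "real \<Rightarrow> nat \<Rightarrow> 'a measure" where
  "alt a k = density P0 (\<lambda>x. ennreal (1 + a * phi k x))"

lemma sets_alt[simp, measurable_cong]: "sets (alt a k) = sets P0"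
  and space_alt[simp]: "space (alt a k) = space P0"
  by (simp_all add: alt_def)

lemma bounded_integrable:
  fixes f :: "'a \<Rightarrow> real"
  assumes "f \<in> borel_measurable P0" "\<And>x. x \<in> space P0 \<Longrightarrow> \<bar>f x\<bar> \<le> B"
  shows "integrable P0 f"
  using assms by (intro P0.integrable_const_bound[where B = B]) auto

lemma phi_mult_integrable: "integrable P0 (\<lambda>x. phi j x * phi k x)"
proof (rule bounded_integrable)
  show "\<bar>phi j x * phi k x\<bar> \<le> C * C" if "x \<in> space P0" for x
    unfolding abs_mult using phi_bdd[OF that] C_pos by (intro mult_mono) auto
qed measurable

context
  fixes a :: real and k :: nat
  assumes a: "\<bar>a\<bar> * C \<le> 1"
begin

lemma alt_density_nonneg: "x \<in> space P0 \<Longrightarrow> 0 \<le> 1 + a * phi k x"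
proof -
  assume "x \<in> space P0"
  then have "\<bar>a * phi k x\<bar> \<le> \<bar>a\<bar> * C"
    using phi_bdd[of x k] by (auto simp: abs_mult intro: mult_left_mono)
  then show ?thesis using a by linarith
qed

lemma integral_alt:
  fixes f :: "'a \<Rightarrow> real"
  assumes f[measurable]: "f \<in> borel_measurable P0" and B: "\<And>x. x \<in> space P0 \<Longrightarrow> \<bar>f x\<bar> \<le> B"
  shows "(\<integral>x. f x \<partial>alt a k) = (\<integral>x. f x \<partial>P0) + a * (\<integral>x. phi k x * f x \<partial>P0)"
proof -
  have fi: "integrable P0 f" using f B by (rule bounded_integrable)
  have "\<bar>phi k x * f x\<bar> \<le> C * B" if "x \<in> space P0" for x
    using that phi_bdd[of x k] B[of x] C_pos by (auto simp: abs_mult intro!: mult_mono)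
  then have pfi: "integrable P0 (\<lambda>x. phi k x * f x)"
    by (intro bounded_integrable) auto
  have "(\<integral>x. f x \<partial>alt a k) = (\<integral>x. (1 + a * phi k x) *\<^sub>R f x \<partial>P0)"
    unfolding alt_def by (rule integral_density) (auto intro!: AE_I2 alt_density_nonneg)
  also have "\<dots> = (\<integral>x. f x + a * (phi k x * f x) \<partial>P0)"
    by (simp add: algebra_simps)
  also have "\<dots> = (\<integral>x. f x \<partial>P0) + a * (\<integral>x. phi k x * f x \<partial>P0)"
    using fi pfi by simp
  finally show ?thesis .
qed

lemma prob_space_alt: "prob_space (alt a k)"
proof
  have "integrable P0 (\<lambda>x. 1 + a * phi k x)"
    using phi_integrable[OF P0.prob_space_axioms refl] by simp
  then have "(\<integral>\<^sup>+x. ennreal (1 + a * phi k x) \<partial>P0) = ennreal (\<integral>x. 1 + a * phi k x \<partial>P0)"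
    by (intro nn_integral_eq_integral) (auto intro!: AE_I2 alt_density_nonneg)
  also have "\<dots> = 1"
    using phi_integrable[OF P0.prob_space_axioms refl] by (simp add: P0.prob_space phi_mean)
  finally show "emeasure (alt a k) (space (alt a k)) = 1"
    by (simp add: alt_def emeasure_density cong: nn_integral_cong)
qed

lemma integral_alt_phi: "(\<integral>x. phi j x \<partial>alt a k) = (if j = k then a else 0)"
  using integral_alt[OF phi_meas phi_bdd, of j] phi_orth[of k j] phi_mean[of j] by auto

text \<open>The only nonzero coefficient is \<open>a\<close> at index \<open>k\<close>, so the
  chi-square distance is \<open>a^2\<close> and the squared RKHS norm is \<open>a^2 / lam k\<close>.
  As \<open>udens\<close> equals \<open>a * phi k\<close> only almost everywhere, each condition is
  transferred through an integral.\<close>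

lemma alt_in_Palt:
  assumes \<Delta>: "\<Delta> \<le> a\<^sup>2" and M: "0 \<le> M" "a\<^sup>2 \<le> M\<^sup>2 * lam k"
  shows "alt a k \<in> Palt P0 lam phi \<Delta> M"
proof -
  let ?u = "udens P0 (alt a k)"
  have um[measurable]: "?u \<in> borel_measurable P0"
    unfolding udens_def by measurable
  have "AE x in P0. ennreal (1 + a * phi k x) = RN_deriv P0 (alt a k) x"
    by (rule P0.RN_deriv_unique) (auto simp: alt_def)
  then have u: "AE x in P0. ?u x = a * phi k x"
    using AE_space
  proof eventually_elim
    case (elim x)
    then show ?case
      using alt_density_nonneg[of x] by (simp add: udens_def elim(1)[symmetric])
  qed
  have cf: "coef P0 phi ?u j = (if j = k then a else 0)" for j
  proof -
    have "coef P0 phi ?u j = (\<integral>x. a * (phi k x * phi j x) \<partial>P0)"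
      unfolding coef_def using u by (intro integral_cong_AE) auto
    then show ?thesis by (simp add: phi_orth)
  qed
  have phi2: "integrable P0 (\<lambda>x. phi k x * phi k x)"
    by (rule phi_mult_integrable)
  have "integrable P0 (\<lambda>x. (?u x)\<^sup>2) = integrable P0 (\<lambda>x. a\<^sup>2 * (phi k x * phi k x))"
    using u by (intro integrable_cong_AE) (auto simp: power2_eq_square)
  then have u2: "integrable P0 (\<lambda>x. (?u x)\<^sup>2)"
    using phi2 by simp
  have "(\<integral>x. ?u x \<partial>P0) = (\<integral>x. a * phi k x \<partial>P0)"
    using u by (intro integral_cong_AE) auto
  then have u0: "(\<integral>x. ?u x \<partial>P0) = 0" by (simp add: phi_mean)
  have "chi2 (alt a k) P0 = (\<integral>x. a\<^sup>2 * (phi k x * phi k x) \<partial>P0)"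
    unfolding chi2_def using u by (intro integral_cong_AE) (auto simp: power2_eq_square)
  then have chi: "chi2 (alt a k) P0 = a\<^sup>2" by (simp add: phi_orth)
  have "(\<lambda>j. if j = k then a\<^sup>2 / lam j else 0) sums (\<Sum>j\<in>{k}. a\<^sup>2 / lam j)"
    using sums_If_finite_set[of "{k}" "\<lambda>j. a\<^sup>2 / lam j"] by simp
  moreover have "(\<lambda>j. (coef P0 phi ?u j)\<^sup>2 / lam j) = (\<lambda>j. if j = k then a\<^sup>2 / lam j else 0)"
    by (auto simp: cf)
  ultimately have s: "(\<lambda>j. (coef P0 phi ?u j)\<^sup>2 / lam j) sums (a\<^sup>2 / lam k)"
    by simp
  have "sqrt (a\<^sup>2 / lam k) \<le> M"
    using M lam_pos[of k] by (intro real_le_lsqrt) (auto simp: field_simps)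
  then have "?u \<in> F0 P0 lam phi M"
    using s u2 u0 by (auto simp: F0_def in_RKHS_def RKHS_norm_def L2_def sums_iff)
  moreover have "absolutely_continuous P0 (alt a k)"
    unfolding alt_def by (rule absolutely_continuousI_density) measurable
  ultimately show ?thesis
    using prob_space_alt chi \<Delta> by (auto simp: Palt_def)
qed

end

section \<open>Limit laws under the perturbed measures\<close>

text \<open>The second claim shows that a perturbation along \<open>phi j\<close> with
  \<open>N \<le> j\<close> does not change the mean of a combination of the first \<open>N\<close>
  eigenfunctions.\<close>

lemma integral_phi_combination:
  fixes b :: "nat \<Rightarrow> real"
  shows "(\<integral>x. (\<Sum>k<N. b k * phi k x) \<partial>P0) = 0"
    and "N \<le> j \<Longrightarrow> (\<integral>x. phi j x * (\<Sum>k<N. b k * phi k x) \<partial>P0) = 0"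
    and "(\<integral>x. (\<Sum>k<N. b k * phi k x)\<^sup>2 \<partial>P0) = (\<Sum>k<N. (b k)\<^sup>2)"
proof -
  have i1: "integrable P0 (phi k)" for k
    by (rule phi_integrable[OF P0.prob_space_axioms refl])
  note i2 = phi_mult_integrable
  show "(\<integral>x. (\<Sum>k<N. b k * phi k x) \<partial>P0) = 0"
    using i1 by (simp add: phi_mean)
  show "(\<integral>x. phi j x * (\<Sum>k<N. b k * phi k x) \<partial>P0) = 0" if "N \<le> j"
    using i2 that by (simp add: sum_distrib_left mult.left_commute phi_orth)
  have "(\<integral>x. (\<Sum>k<N. b k * phi k x)\<^sup>2 \<partial>P0)
      = (\<integral>x. (\<Sum>k<N. \<Sum>j<N. (b k * b j) * (phi k x * phi j x)) \<partial>P0)"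
    by (simp add: power2_eq_square sum_product mult_ac)
  also have "\<dots> = (\<Sum>k<N. \<Sum>j<N. (b k * b j) * (if k = j then 1 else 0))"
    using i2 by (simp add: phi_orth)
  finally show "(\<integral>x. (\<Sum>k<N. b k * phi k x)\<^sup>2 \<partial>P0) = (\<Sum>k<N. (b k)\<^sup>2)"
    by (simp add: power2_eq_square if_distrib[of "\<lambda>x. _ * x"] cong: if_cong)
qed

text \<open>Central limit theorem for a triangular array of laws. The mean is exactly 0 as soon as
  \<open>\<kappa> n\<close> reaches \<open>N\<close>, and the variance is off by at most
  \<open>\<bar>a n\<bar> * (C * B^2)\<close>, which vanishes in the limit.\<close>

lemma char_alt_tendsto:
  fixes b :: "nat \<Rightarrow> real"
  assumes a: "\<And>n. \<bar>a n\<bar> * C \<le> 1" "a \<longlonglongrightarrow> 0" and \<kappa>: "filterlim \<kappa> at_top sequentially"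
  shows "(\<lambda>n. char (distr (alt (a n) (\<kappa> n)) borel (\<lambda>x. \<Sum>k<N. b k * phi k x)) (1 / sqrt (real n)) ^ n)
    \<longlonglongrightarrow> complex_of_real (exp (- (\<Sum>k<N. (b k)\<^sup>2) / 2))"
proof -
  define h where "h x = (\<Sum>k<N. b k * phi k x)" for x
  define v where "v = (\<Sum>k<N. (b k)\<^sup>2)"
  define B where "B = (\<Sum>k<N. \<bar>b k\<bar> * C)"
  have v: "0 \<le> v" by (simp add: v_def sum_nonneg)
  have hm[measurable]: "h \<in> borel_measurable P0"
    unfolding h_def by measurable
  have hB: "\<bar>h x\<bar> \<le> B" if "x \<in> space P0" for x
    unfolding h_def B_def using phi_bdd[OF that]
    by (intro order_trans[OF sum_abs] sum_mono) (auto simp: abs_mult intro: mult_left_mono)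
  have h2B: "\<bar>(h x)\<^sup>2\<bar> \<le> B\<^sup>2" if "x \<in> space P0" for x
    using power_mono[OF hB[OF that] abs_ge_zero, of 2] by simp
  note hint = integral_phi_combination[where N = N and b = b, folded h_def v_def]
  let ?c = "\<lambda>n. char (distr (alt (a n) (\<kappa> n)) borel h) (1 / sqrt (real n)) ^ n"
  let ?e = "\<lambda>n. complex_of_real ((1 - v / 2 / real n) ^ n)"
  let ?err = "\<lambda>n. B ^ 3 / (6 * sqrt (real n)) + \<bar>a n\<bar> * (C * B\<^sup>2) / 2"
  have "\<forall>\<^sub>F n in sequentially. v / 4 \<le> real n"
    by (rule filterlim_real_sequentially[unfolded filterlim_at_top, rule_format])
  then have "\<forall>\<^sub>F n in sequentially. norm (?c n - ?e n) \<le> ?err n"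
    using eventually_gt_at_top[of 0] \<kappa>[unfolded filterlim_at_top, rule_format, of N]
  proof eventually_elim
    case (elim n)
    interpret Q: prob_space "alt (a n) (\<kappa> n)" by (rule prob_space_alt[OF a(1)])
    have "(\<integral>x. h x \<partial>alt (a n) (\<kappa> n)) = 0"
      using integral_alt[OF a(1) hm hB, of n "\<kappa> n"] hint(1) hint(2)[OF elim(3)] by simp
    then have "norm (?c n - ?e n) \<le> B ^ 3 / (6 * sqrt (real n)) + \<bar>(\<integral>x. (h x)\<^sup>2 \<partial>alt (a n) (\<kappa> n)) - v\<bar> / 2"
      using elim v hB by (intro char_power_diff_le Q.prob_space_axioms) auto
    also have "(\<integral>x. (h x)\<^sup>2 \<partial>alt (a n) (\<kappa> n)) = v + a n * (\<integral>x. phi (\<kappa> n) x * (h x)\<^sup>2 \<partial>P0)"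
      using integral_alt[OF a(1) borel_measurable_power[OF hm] h2B] hint(3) by simp
    also have "\<bar>v + a n * (\<integral>x. phi (\<kappa> n) x * (h x)\<^sup>2 \<partial>P0) - v\<bar> \<le> \<bar>a n\<bar> * (C * B\<^sup>2)"
    proof -
      have pb: "\<bar>phi (\<kappa> n) x * (h x)\<^sup>2\<bar> \<le> C * B\<^sup>2" if "x \<in> space P0" for x
        unfolding abs_mult using phi_bdd[OF that] h2B[OF that] C_pos by (intro mult_mono) auto
      have "integrable P0 (\<lambda>x. phi (\<kappa> n) x * (h x)\<^sup>2)"
        by (rule bounded_integrable[OF _ pb]) measurable
      then have "(\<integral>x. \<bar>phi (\<kappa> n) x * (h x)\<^sup>2\<bar> \<partial>P0) \<le> (\<integral>x. C * B\<^sup>2 \<partial>P0)"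
        by (intro integral_mono pb) auto
      then have "\<bar>\<integral>x. phi (\<kappa> n) x * (h x)\<^sup>2 \<partial>P0\<bar> \<le> C * B\<^sup>2"
        by (intro order_trans[OF integral_abs_bound]) (simp add: P0.prob_space)
      then show ?thesis by (simp add: abs_mult mult_left_mono)
    qed
    finally show ?case by simp
  qed
  moreover have "?err \<longlonglongrightarrow> 0"
  proof -
    have "(\<lambda>n. B ^ 3 / (6 * sqrt (real n))) \<longlonglongrightarrow> 0"
      by real_asymp
    moreover have "(\<lambda>n. \<bar>a n\<bar> * (C * B\<^sup>2) / 2) \<longlonglongrightarrow> \<bar>0\<bar> * (C * B\<^sup>2) / 2"
      by (intro tendsto_intros a(2)) auto
    ultimately have "?err \<longlonglongrightarrow> 0 + \<bar>0\<bar> * (C * B\<^sup>2) / 2" by (rule tendsto_add)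
    then show ?thesis by simp
  qed
  ultimately have "(\<lambda>n. ?c n - ?e n) \<longlonglongrightarrow> 0"
    by (rule Lim_null_comparison)
  moreover have "?e \<longlonglongrightarrow> complex_of_real (exp (- v / 2))"
    using tendsto_exp_limit_sequentially[of "- v / 2"] by (intro tendsto_of_real) simp
  ultimately have "(\<lambda>n. (?c n - ?e n) + ?e n) \<longlonglongrightarrow> 0 + complex_of_real (exp (- v / 2))"
    by (rule tendsto_add)
  then show ?thesis by (simp add: h_def[abs_def] v_def)
qed

text \<open>Gaussian linearisation reduces the claim to one-dimensional characteristic functions at
  each fixed \<open>z\<close>; these have modulus at most 1, so dominated convergence carries the
  limit through the Gaussian integral.\<close>

lemma laplace_alt_tendsto:
  assumes a: "\<And>n. \<bar>a n\<bar> * C \<le> 1" "a \<longlonglongrightarrow> 0" and \<kappa>: "filterlim \<kappa> at_top sequentially" and \<tau>: "0 < \<tau>"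
  shows "(\<lambda>n. \<integral>x. exp (- \<tau> * (\<Sum>k<N. lam k / real n * (\<Sum>i<n. phi k (x i))\<^sup>2))
      \<partial>PiM {..<n} (\<lambda>_. alt (a n) (\<kappa> n))) \<longlonglongrightarrow> (\<Prod>k<N. 1 / sqrt (1 + 2 * (\<tau> * lam k)))"
    (is "?I \<longlonglongrightarrow> _")
proof -
  let ?Z = "PiM {..<N} (\<lambda>_. std_normal_distribution)"
  interpret Z: prob_space ?Z by (intro prob_space_PiM prob_space_std_normal)
  \<comment> \<open>The factor \<open>2 * \<tau>\<close> offsets the division by 2 in the linearised
    exponent; \<open>1 / real n\<close> enters as the square of the argument
    \<open>1 / sqrt (real n)\<close>.\<close>
  define g where "g k x = sqrt (2 * \<tau> * lam k) * phi k x" for k x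
  have gm: "g k \<in> borel_measurable (alt (a n) (\<kappa> n))" for k n
    unfolding g_def by measurable
  have prob: "prob_space (alt (a n) (\<kappa> n))" for n
    by (rule prob_space_alt[OF a(1)])
  let ?c = "\<lambda>n z. char (distr (alt (a n) (\<kappa> n)) borel (\<lambda>x. \<Sum>k<N. z k * g k x)) (1 / sqrt (real n)) ^ n"
  have I: "complex_of_real (?I n) = (\<integral>z. ?c n z \<partial>?Z)" for n
  proof -
    have "- ((1 / sqrt (real n))\<^sup>2 * (\<Sum>k<N. (\<Sum>i<n. g k (x i))\<^sup>2)) / 2
        = - \<tau> * (\<Sum>k<N. lam k / real n * (\<Sum>i<n. phi k (x i))\<^sup>2)" for x
    proof -
      have "(\<Sum>i<n. g k (x i))\<^sup>2 = 2 * \<tau> * lam k * (\<Sum>i<n. phi k (x i))\<^sup>2" for k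
        using \<tau> lam_nonneg[of k] by (simp add: g_def sum_distrib_left[symmetric] power_mult_distrib)
      then show ?thesis
        by (simp add: power_divide sum_distrib_left sum_divide_distrib sum_negf)
    qed
    then show ?thesis
      using laplace_PiM_sum_square[where t = "1 / sqrt (real n)" and N = N and n = n and g = g, OF prob gm]
      by (simp only:)
  qed
  have "(\<lambda>n. \<integral>z. ?c n z \<partial>?Z) \<longlonglongrightarrow> (\<integral>z. complex_of_real (exp (- (\<Sum>k<N. \<tau> * lam k * (z k)\<^sup>2))) \<partial>?Z)"
  proof (rule integral_dominated_convergence[where w = "\<lambda>_. 1"])
    show "?c n \<in> borel_measurable ?Z" for n
      using char_linear_measurable[where t = "1 / sqrt (real n)" and N = N and g = g, OF prob gm] by measurable
    show "AE z in ?Z. norm (?c n z) \<le> 1" for n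
    proof (rule AE_I2)
      fix z
      interpret Q: prob_space "alt (a n) (\<kappa> n)" by (rule prob)
      interpret D: real_distribution "distr (alt (a n) (\<kappa> n)) borel (\<lambda>x. \<Sum>k<N. z k * g k x)"
        by (intro Q.real_distribution_distr borel_measurable_sum borel_measurable_times gm) simp
      show "norm (?c n z) \<le> 1"
        unfolding norm_power by (intro power_le_one D.cmod_char_le_1) simp
    qed
    show "AE z in ?Z. (\<lambda>n. ?c n z) \<longlonglongrightarrow> complex_of_real (exp (- (\<Sum>k<N. \<tau> * lam k * (z k)\<^sup>2)))"
    proof (rule AE_I2)
      fix z
      have "(\<lambda>x. \<Sum>k<N. z k * g k x) = (\<lambda>x. \<Sum>k<N. (z k * sqrt (2 * \<tau> * lam k)) * phi k x)"
        by (simp add: g_def mult.assoc)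
      moreover have "- (\<Sum>k<N. (z k * sqrt (2 * \<tau> * lam k))\<^sup>2) / 2 = - (\<Sum>k<N. \<tau> * lam k * (z k)\<^sup>2)"
        using \<tau> lam_nonneg by (simp add: power_mult_distrib sum_divide_distrib mult_ac)
      ultimately show "(\<lambda>n. ?c n z) \<longlonglongrightarrow> complex_of_real (exp (- (\<Sum>k<N. \<tau> * lam k * (z k)\<^sup>2)))"
        using char_alt_tendsto[where N = N and b = "\<lambda>k. z k * sqrt (2 * \<tau> * lam k)", OF a \<kappa>]
        by (simp only:)
    qed
  qed auto
  also have "(\<integral>z. complex_of_real (exp (- (\<Sum>k<N. \<tau> * lam k * (z k)\<^sup>2))) \<partial>?Z)
      = complex_of_real (\<integral>z. exp (- (\<Sum>k<N. \<tau> * lam k * (z k)\<^sup>2)) \<partial>?Z)"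
    by (rule integral_complex_of_real)
  also have "(\<integral>z. exp (- (\<Sum>k<N. \<tau> * lam k * (z k)\<^sup>2)) \<partial>?Z) = (\<Prod>k<N. 1 / sqrt (1 + 2 * (\<tau> * lam k)))"
    using \<tau> lam_nonneg by (intro integral_PiM_std_normal_exp_neg) simp
  finally show ?thesis
    unfolding I[symmetric] tendsto_of_real_iff .
qed

section \<open>Acceptance under a perturbation of critical size\<close>

text \<open>Markov's inequality for \<open>exp (- \<tau> * T)\<close>, where the statistic \<open>T\<close> is split at the index \<open>N\<close>
  and \<open>exp (- \<tau> * tail) \<ge> 1 - \<tau> * tail\<close>.\<close>
lemma accept_prob_ge:
  assumes P: "prob_space P" "sets P = sets P0" and n: "0 < n" and \<tau>: "0 < \<tau>"
  shows "(\<integral>x. exp (- \<tau> * (\<Sum>k<N. lam k / real n * (\<Sum>i<n. phi k (x i))\<^sup>2)) \<partial>PiM {..<n} (\<lambda>_. P))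
      - \<tau> * (\<Sum>k. lam (k + N) * (C\<^sup>2 + real n * (\<integral>x. phi (k + N) x \<partial>P)\<^sup>2)) - exp (- \<tau> * q_w lam \<alpha>)
    \<le> (\<integral>x. 1 - T_MMD lam phi \<alpha> n x \<partial>PiM {..<n} (\<lambda>_. P))"
proof -
  let ?Q = "PiM {..<n} (\<lambda>_. P)"
  interpret P: prob_space P by (rule P)
  interpret Q: prob_space ?Q by (intro prob_space_PiM P)
  define f where "f k x = lam k / real n * (\<Sum>i<n. phi k (x i))\<^sup>2" for k x
  define hd where "hd x = (\<Sum>k<N. f k x)" for x
  define tl where "tl x = (\<Sum>k. f (k + N) x)" for x
  note [measurable] = phi_meas'[OF P]
  have f0: "0 \<le> f k x" for k x
    using lam_nonneg by (simp add: f_def)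
  have hdm[measurable]: "hd \<in> borel_measurable ?Q"
    unfolding hd_def f_def by measurable
  have hd0: "0 \<le> hd x" for x
    unfolding hd_def by (intro sum_nonneg f0)
  have sf: "summable (\<lambda>k. f k x)" if "x \<in> space ?Q" for x
    unfolding f_def by (rule phi_sum_square_summable[OF P that])
  have w: "0 \<le> lam (k + N) / real n" "summable (\<lambda>k. lam (k + N) / real n)" for k
    using lam_nonneg lam_div_summable by (auto simp only: summable_iff_shift[of "\<lambda>k. lam k / real n"] intro!: divide_nonneg_nonneg)
  have tli: "integrable ?Q tl"
    unfolding tl_def[abs_def] f_def
    by (rule weighted_sum_square_PiM(2)[OF P(1) phi_meas'[OF P] phi_bdd'[OF P] w])
  have "(\<integral>x. tl x \<partial>?Q) \<le> (\<Sum>k. lam (k + N) / real n * (real n * C\<^sup>2 + (real n * (\<integral>x. phi (k + N) x \<partial>P))\<^sup>2))"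
    unfolding tl_def f_def
    by (rule weighted_sum_square_PiM(3)[OF P(1) phi_meas'[OF P] phi_bdd'[OF P] w])
  also have "\<dots> = (\<Sum>k. lam (k + N) * (C\<^sup>2 + real n * (\<integral>x. phi (k + N) x \<partial>P)\<^sup>2))"
    using n by (intro suminf_cong) (simp add: field_simps power2_eq_square)
  finally have Etl: "(\<integral>x. tl x \<partial>?Q) \<le> (\<Sum>k. lam (k + N) * (C\<^sup>2 + real n * (\<integral>x. phi (k + N) x \<partial>P)\<^sup>2))" .
  have expi: "integrable ?Q (\<lambda>x. exp (- \<tau> * hd x))"
    using hd0 \<tau> by (intro Q.integrable_const_bound[where B = 1]) (auto intro!: AE_I2)
  \<comment> \<open>On acceptance the right side is 1, which bounds the left side. On rejection
    \<open>hd x + tl x\<close> exceeds the critical value, which makes the left side at most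
    0.\<close>
  have "exp (- \<tau> * hd x) - \<tau> * tl x - exp (- \<tau> * q_w lam \<alpha>) \<le> 1 - T_MMD lam phi \<alpha> n x" if x: "x \<in> space ?Q" for x
  proof -
    have tl0: "0 \<le> tl x"
      unfolding tl_def using sf[OF x] f0
      by (intro suminf_nonneg) (simp_all add: summable_iff_shift[of "\<lambda>k. f k x"])
    have e1: "exp (- \<tau> * hd x) \<le> 1" using hd0 \<tau> by simp
    show ?thesis
    proof (cases "real n * mmd_sq lam phi n x > q_w lam \<alpha>")
      case False
      have "0 \<le> \<tau> * tl x" using \<tau> tl0 by simp
      then show ?thesis
        using False e1 exp_ge_zero[of "- \<tau> * q_w lam \<alpha>"] unfolding T_MMD_def if_not_P[OF False] by linarith
    next
      case True
      have "real n * mmd_sq lam phi n x = tl x + hd x"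
        using mmd_sq_eq[OF P x n] suminf_split_initial_segment[OF sf[OF x], of N]
        by (simp add: f_def tl_def hd_def)
      then have "- \<tau> * (tl x + hd x) \<le> - \<tau> * q_w lam \<alpha>"
        using True \<tau> by simp
      then have "exp (- \<tau> * hd x) * exp (- \<tau> * tl x) \<le> exp (- \<tau> * q_w lam \<alpha>)"
        by (simp add: exp_add[symmetric] algebra_simps)
      moreover have "exp (- \<tau> * hd x) * (1 - \<tau> * tl x) \<le> exp (- \<tau> * hd x) * exp (- \<tau> * tl x)"
        using exp_ge_add_one_self[of "- \<tau> * tl x"] by (intro mult_left_mono) auto
      moreover have "exp (- \<tau> * hd x) * (\<tau> * tl x) \<le> 1 * (\<tau> * tl x)"
        using \<tau> tl0 by (intro mult_right_mono e1) simp
      ultimately show ?thesis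
        using True by (simp add: T_MMD_def right_diff_distrib)
    qed
  qed
  then have "(\<integral>x. exp (- \<tau> * hd x) - \<tau> * tl x - exp (- \<tau> * q_w lam \<alpha>) \<partial>?Q) \<le> (\<integral>x. 1 - T_MMD lam phi \<alpha> n x \<partial>?Q)"
    using expi tli by (intro integral_mono accept_integrable[OF P]) auto
  moreover have "(\<integral>x. exp (- \<tau> * hd x) - \<tau> * tl x - exp (- \<tau> * q_w lam \<alpha>) \<partial>?Q)
      = (\<integral>x. exp (- \<tau> * hd x) \<partial>?Q) - \<tau> * (\<integral>x. tl x \<partial>?Q) - exp (- \<tau> * q_w lam \<alpha>)"
    using expi tli by (simp add: Q.prob_space)
  moreover have "\<tau> * (\<integral>x. tl x \<partial>?Q) \<le> \<tau> * (\<Sum>k. lam (k + N) * (C\<^sup>2 + real n * (\<integral>x. phi (k + N) x \<partial>P)\<^sup>2))"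
    using Etl \<tau> by (intro mult_left_mono) auto
  ultimately show ?thesis
    unfolding hd_def f_def by linarith
qed

text \<open>Since \<open>N \<le> j\<close>, the whole signal lies in the tail, at shifted index
  \<open>j - N\<close>, and contributes the single term \<open>real n * lam j * a^2\<close>.\<close>

lemma accept_prob_alt_ge:
  assumes a: "\<bar>a\<bar> * C \<le> 1" and j: "N \<le> j" and n: "0 < n" and \<tau>: "0 < \<tau>"
  shows "(\<integral>x. exp (- \<tau> * (\<Sum>k<N. lam k / real n * (\<Sum>i<n. phi k (x i))\<^sup>2)) \<partial>PiM {..<n} (\<lambda>_. alt a j))
      - \<tau> * (C\<^sup>2 * (\<Sum>k. lam (k + N)) + real n * lam j * a\<^sup>2) - exp (- \<tau> * q_w lam \<alpha>)
    \<le> (\<integral>x. 1 - T_MMD lam phi \<alpha> n x \<partial>PiM {..<n} (\<lambda>_. alt a j))"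
proof -
  have "(\<lambda>k. lam (k + N) * C\<^sup>2) sums ((\<Sum>k. lam (k + N)) * C\<^sup>2)"
    using lam_summable by (intro sums_mult2 summable_sums) (simp add: summable_iff_shift)
  moreover have "(\<lambda>k. if k = j - N then lam j * (real n * a\<^sup>2) else 0) sums (lam j * (real n * a\<^sup>2))"
    using sums_If_finite_set[of "{j - N}" "\<lambda>_. lam j * (real n * a\<^sup>2)"] by simp
  ultimately have "(\<lambda>k. lam (k + N) * C\<^sup>2 + (if k = j - N then lam j * (real n * a\<^sup>2) else 0))
      sums ((\<Sum>k. lam (k + N)) * C\<^sup>2 + lam j * (real n * a\<^sup>2))"
    by (rule sums_add)
  moreover have "(\<lambda>k. lam (k + N) * (C\<^sup>2 + real n * (\<integral>x. phi (k + N) x \<partial>alt a j)\<^sup>2))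
      = (\<lambda>k. lam (k + N) * C\<^sup>2 + (if k = j - N then lam j * (real n * a\<^sup>2) else 0))"
    using j by (auto simp: integral_alt_phi[OF a] fun_eq_iff distrib_left)
  ultimately have "(\<Sum>k. lam (k + N) * (C\<^sup>2 + real n * (\<integral>x. phi (k + N) x \<partial>alt a j)\<^sup>2))
      = C\<^sup>2 * (\<Sum>k. lam (k + N)) + real n * lam j * a\<^sup>2"
    by (simp add: sums_iff mult_ac)
  then show ?thesis
    using accept_prob_ge[where N = N and \<alpha> = \<alpha>, OF prob_space_alt[OF a, of j] sets_alt n \<tau>] by simp
qed

lemma typeII_liminf_pos:
  assumes dec: "decseq lam" and D: "0 \<le> D" "\<forall>\<^sub>F k in sequentially. lam k \<le> D * lam (Suc k)"
    and M: "0 < M" and \<alpha>: "0 < \<alpha>" "\<alpha> < 1"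
  shows "\<exists>c0>0. Liminf sequentially (\<lambda>n. ereal (typeII P0 lam phi \<alpha> (c0 / sqrt (real n)) M n)) > 0"
proof -
  define q where "q = q_w lam \<alpha>"
  have q: "0 < q"
    unfolding q_def by (rule q_w_pos[OF lam_pos lam_summable \<alpha>])
  \<comment> \<open>The bound is uniform in \<open>N\<close>, so \<tau> can be fixed first and the
    truncation index chosen afterwards in terms of it.\<close>
  obtain \<tau> where \<tau>: "0 < \<tau>" and prod: "\<And>N. exp (- \<tau> * q / 2) \<le> (\<Prod>k<N. 1 / sqrt (1 + 2 * (\<tau> * lam k)))"
    using exists_laplace_prod_ge[OF lam_nonneg lam_summable q] by blast
  \<comment> \<open>The available gap. Convergence of the Laplace transform, the tail noise and the
    signal may each use up a quarter of it; the last quarter bounds the type II error from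
    below.\<close>
  define \<eta> where "\<eta> = exp (- \<tau> * q / 2) - exp (- \<tau> * q)"
  have \<eta>: "0 < \<eta>"
    using \<tau> q by (simp add: \<eta>_def)
  obtain N where "\<bar>\<Sum>k. lam (k + N)\<bar> < \<eta> / (4 * \<tau> * C\<^sup>2)"
    using suminf_exist_split[OF _ lam_summable, of "\<eta> / (4 * \<tau> * C\<^sup>2)"] \<eta> \<tau> C_pos by auto
  then have tail: "\<tau> * (C\<^sup>2 * (\<Sum>k. lam (k + N))) \<le> \<eta> / 4"
    using \<tau> C_pos by (simp add: field_simps abs_less_iff)
  \<comment> \<open>Solves the signal budget
    \<open>\<tau> * D * c0^2 / M^2 \<le> \<eta> / 4\<close>; dividing by \<open>D + 1\<close>
    remains meaningful under the mere assumption \<open>0 \<le> D\<close>.\<close>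
  define c0 where "c0 = sqrt (\<eta> * M\<^sup>2 / (4 * \<tau> * (D + 1)))"
  have c0: "0 < c0"
    using \<eta> M \<tau> D(1) by (simp add: c0_def)
  have c02: "\<tau> * (D * c0\<^sup>2 / M\<^sup>2) \<le> \<eta> / 4"
  proof -
    have "\<tau> * (D * c0\<^sup>2 / M\<^sup>2) = \<eta> / 4 * (D / (D + 1))"
      using \<eta> M \<tau> D(1) by (simp add: c0_def)
    also have "\<dots> \<le> \<eta> / 4 * 1"
      using \<eta> D(1) by (intro mult_left_mono) auto
    finally show ?thesis by simp
  qed
  \<comment> \<open>At this level \<open>M^2 * eps n\<close> is the required chi-square distance, so
    \<open>eps n \<le> lam (\<kappa> n)\<close> is exactly the RKHS constraint, while the matching
    upper bound keeps the signal small.\<close>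
  define eps where "eps n = c0 / (M\<^sup>2 * sqrt (real n))" for n
  have "eps \<longlonglongrightarrow> 0"
    unfolding eps_def using M by real_asymp
  moreover have "0 < eps n" if "0 < n" for n
    using that c0 M by (simp add: eps_def)
  ultimately obtain \<kappa> where \<kappa>: "filterlim \<kappa> at_top sequentially"
    and scale: "\<forall>\<^sub>F n in sequentially. eps n \<le> lam (\<kappa> n) \<and> lam (\<kappa> n) \<le> D * eps n"
    using eigenvalue_at_scale[OF lam_pos dec summable_LIMSEQ_zero[OF lam_summable] D(2,1)] by metis
  \<comment> \<open>The minimum ensures a valid density for every \<open>n\<close>; it is attained
    by the second argument for all large \<open>n\<close>.\<close>
  define a where "a n = min (1 / C) (sqrt (c0 / sqrt (real n)))" for n
  have a1: "\<bar>a n\<bar> * C \<le> 1" for n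
    using C_pos c0 by (auto simp: a_def min_def field_simps)
  have sq0: "(\<lambda>n. sqrt (c0 / sqrt (real n))) \<longlonglongrightarrow> 0"
    using c0 by real_asymp
  have a2: "a \<longlonglongrightarrow> 0"
    using tendsto_min[OF tendsto_const sq0, of "1 / C"] C_pos by (simp add: a_def[abs_def])
  have a3: "\<forall>\<^sub>F n in sequentially. a n = sqrt (c0 / sqrt (real n))"
    using order_tendstoD(2)[OF sq0, of "1 / C"] C_pos by (auto elim!: eventually_mono simp: a_def)
  let ?I = "\<lambda>n. \<integral>x. exp (- \<tau> * (\<Sum>k<N. lam k / real n * (\<Sum>i<n. phi k (x i))\<^sup>2))
      \<partial>PiM {..<n} (\<lambda>_. alt (a n) (\<kappa> n))"
  have "\<forall>\<^sub>F n in sequentially. exp (- \<tau> * q / 2) - \<eta> / 4 < ?I n"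
    by (rule order_tendstoD(1)[OF laplace_alt_tendsto[OF a1 a2 \<kappa> \<tau>]]) (use prod[of N] \<eta> in linarith)
  then have "\<forall>\<^sub>F n in sequentially. \<eta> / 4 \<le> typeII P0 lam phi \<alpha> (c0 / sqrt (real n)) M n"
    using scale a3 eventually_gt_at_top[of 0] \<kappa>[unfolded filterlim_at_top, rule_format, of N]
  proof eventually_elim
    case (elim n)
    have an: "(a n)\<^sup>2 = c0 / sqrt (real n)"
      using elim(3) c0 by simp
    have Me: "M\<^sup>2 * eps n = c0 / sqrt (real n)"
      using M by (simp add: eps_def)
    have "(a n)\<^sup>2 \<le> M\<^sup>2 * lam (\<kappa> n)"
      unfolding an Me[symmetric] using elim(2) by (intro mult_left_mono) auto
    then have mem: "alt (a n) (\<kappa> n) \<in> Palt P0 lam phi (c0 / sqrt (real n)) M"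
      using an M by (intro alt_in_Palt a1) auto
    have "real n * lam (\<kappa> n) * (a n)\<^sup>2 \<le> real n * (D * eps n) * (a n)\<^sup>2"
      using elim(2) by (intro mult_right_mono mult_left_mono) auto
    also have "\<dots> = D * c0\<^sup>2 / M\<^sup>2"
      unfolding an eps_def using elim(4) M by (simp add: field_simps power2_eq_square)
    finally have "\<tau> * (real n * lam (\<kappa> n) * (a n)\<^sup>2) \<le> \<tau> * (D * c0\<^sup>2 / M\<^sup>2)"
      using \<tau> by (intro mult_left_mono) auto
    then have noise: "\<tau> * (C\<^sup>2 * (\<Sum>k. lam (k + N)) + real n * lam (\<kappa> n) * (a n)\<^sup>2) \<le> \<eta> / 4 + \<eta> / 4"
      using tail c02 unfolding distrib_left[of \<tau>] by linarith
    have arith: "\<eta> / 4 \<le> A" if "I - S - E \<le> A" "e - \<eta> / 4 < I" "S \<le> \<eta> / 4 + \<eta> / 4" "\<eta> = e - E"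
      for A I S e E :: real
      using that by linarith
    have "\<eta> / 4 \<le> (\<integral>x. 1 - T_MMD lam phi \<alpha> n x \<partial>PiM {..<n} (\<lambda>_. alt (a n) (\<kappa> n)))"
      by (rule arith[OF accept_prob_alt_ge[where \<alpha> = \<alpha>, OF a1[of n] elim(5,4) \<tau>, folded q_def] elim(1) noise \<eta>_def])
    also have "\<dots> \<le> typeII P0 lam phi \<alpha> (c0 / sqrt (real n)) M n"
      by (rule typeII_ge[OF mem])
    finally show ?case .
  qed
  then have "ereal (\<eta> / 4) \<le> Liminf sequentially (\<lambda>n. ereal (typeII P0 lam phi \<alpha> (c0 / sqrt (real n)) M n))"
    by (intro Liminf_bounded) simp
  moreover have "0 < ereal (\<eta> / 4)"
    using \<eta> by simp
  ultimately have "0 < Liminf sequentially (\<lambda>n. ereal (typeII P0 lam phi \<alpha> (c0 / sqrt (real n)) M n))"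
    by (rule less_le_trans[rotated])
  then show ?thesis using c0 by blast
qed

end

theorem theorem1:
  fixes P0 :: "'a measure" and K :: "'a \<Rightarrow> 'a \<Rightarrow> real"
    and lam :: "nat \<Rightarrow> real" and phi :: "nat \<Rightarrow> 'a \<Rightarrow> real"
    and s M \<alpha> :: real
  assumes P0: "prob_space P0"
    and phi_meas: "\<And>k. phi k \<in> borel_measurable P0"
    and phi_orth: "\<And>j k. (\<integral>x. phi j x * phi k x \<partial>P0) = (if j = k then 1 else 0)"
    and phi_mean: "\<And>k. (\<integral>x. phi k x \<partial>P0) = 0"
    and phi_complete: "\<And>f. L2 P0 f \<Longrightarrow> (\<integral>x. f x \<partial>P0) = 0 \<Longrightarrow>
                          (\<forall>k. (\<integral>x. f x * phi k x \<partial>P0) = 0) \<Longrightarrow> AE x in P0. f x = 0"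
    and phi_bdd: "\<exists>C. \<forall>k. \<forall>x\<in>space P0. \<bar>phi k x\<bar> \<le> C"
    and mercer: "\<And>x x'. x \<in> space P0 \<Longrightarrow> x' \<in> space P0 \<Longrightarrow>
                    K x x' = (\<Sum>k. lam k * phi k x * phi k x')"
    and lam_pos: "\<And>k. lam k > 0"
    and lam_decr: "\<And>k. lam (Suc k) < lam k"
    and s: "s > 1/2"
    and decay_lo: "Liminf sequentially (\<lambda>k. ereal (real (Suc k) powr (2 * s) * lam k)) > 0"
    and decay_hi: "Limsup sequentially (\<lambda>k. ereal (real (Suc k) powr (2 * s) * lam k)) < \<infinity>"
    and M: "M > 0"
    and \<alpha>: "0 < \<alpha>" "\<alpha> < 1"
  shows "(\<forall>\<Delta> :: nat \<Rightarrow> real. (\<forall>n. \<Delta> n > 0) \<longrightarrow>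
            filterlim (\<lambda>n. sqrt (real n) * \<Delta> n) at_top sequentially \<longrightarrow>
            (\<lambda>n. typeII P0 lam phi \<alpha> (\<Delta> n) M n) \<longlonglongrightarrow> 0)
       \<and> (\<exists>c0 > 0. Liminf sequentially
              (\<lambda>n. ereal (typeII P0 lam phi \<alpha> (c0 / sqrt (real n)) M n)) > 0)"
proof -
  obtain C where C: "\<And>k x. x \<in> space P0 \<Longrightarrow> \<bar>phi k x\<bar> \<le> C"
    using phi_bdd by blast
  note decay = polynomial_decay[OF lam_pos s decay_lo decay_hi]
  interpret P0: prob_space P0 by (rule P0)
  \<comment> \<open>The maximum with 1 provides the positivity demanded of the bound.\<close>
  interpret complete_eigensystem P0 lam phi "max C 1"
  proof
    show "\<bar>phi k x\<bar> \<le> max C 1" if "x \<in> space P0" for k x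
      using C[OF that, of k] by simp
  qed (use phi_meas phi_orth phi_mean lam_pos decay(1) phi_complete in auto)
  have "decseq lam"
    using lam_decr by (intro decseq_SucI less_imp_le)
  then show ?thesis
    using typeII_tendsto_0[OF M] typeII_liminf_pos[OF _ _ _ M \<alpha>] decay(2) by blast
qed

end
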